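(* Let $P$ be a finite poset that is neither a chain nor an antichain, and let $n$ be sufficiently large (depending on $P$). Then every independent set in $G_P^*[\mathcal M_n]$ is either a chain of sets or a union of two chains. Furthermore: (1) If $P$ is incomparable good, then $\alpha(G_P^*[\mathcal M_n])=\sigma(P)$, where $\sigma(P)$ can be arbitrarily large (i.e. for every $M$ there is an incomparable good poset $P$ with $\sigma(P)\ge M$). (2) If $P$ is incomparable upper bad or incomparable lower bad, then $\alpha(G_P^*[\mathcal M_n])=2$. (3) If $P$ is incomparable mixed bad, then $\alpha(G_P^*[\mathcal M_n])=\max\{\sigma(P),\min\{\lambda^-(P)+\lambda^+(P),2\sigma(P)\}\}$.
   Context: $[n]=\{1,\dots,n\}$. A family $\mathcal G$ of sets is a strong copy of a poset $(P,\preceq)$ if there is a bijection $\iota:P\to\mathcal G$ such that $p\preceq q$ if and only if $\iota(p)\subseteq\iota(q)$; such a map $\iota:P\to 2^{[N]}$ (injective, onto its image) is a strong embedding. $\mathcal M_n=\{F\subseteq[n]: \big||F|-n/2\big|\le n^{2/3}\}$. $G_P^*(n)$ is the graph on vertex set $2^{[n]}$ in which distinct sets $F,G$ are adjacent if and only if some strong copy of $P$ in $2^{[n]}$ contains both; $G_P^*[\mathcal M_n]$ is its subgraph induced on $\mathcal M_n$; $\alpha$ is the independence number. Let $U_P(x)=\{y\in P: x\prec y\}$, $D_P(x)=\{y\in P: y\prec x\}$ (strict relations), and write $p\perp q$ if $p,q$ are incomparable. An incomparable pair $(p,q)$ is strong upper bad if $|U_P(p)\cap U_P(q)|\ge2$,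 or $|U_P(p)\cap U_P(q)|=1$ and $P$ has no largest element. It is strong lower bad if $|D_P(p)\cap D_P(q)|\ge2$, or $|D_P(p)\cap D_P(q)|=1$ and $P$ has no smallest element. It is strong bad if it is strong upper bad or strong lower bad, and strong good otherwise. $P$ is incomparable good if it contains a strong good incomparable pair; incomparable upper (lower) bad if all incomparable pairs are strong upper (lower) bad; incomparable mixed bad if every incomparable pair is strong bad but $P$ is neither incomparable upper bad nor incomparable lower bad. Let $\mathcal E(P)=\{(N,\iota): N \text{ a positive integer and } \iota:P\to2^{[N]}\text{ a strong embedding}\}$. Define $$\sigma(P)=\min\{|\iota(q)\setminus\iota(p)| : (N,\iota)\in\mathcal E(P),\ p\prec q \text{ in } P\}.$$ For incomparable mixed bad $P$ define $$\lambda^-(P)=\min\{|\iota(p)\cap\iota(q)| : (N,\iota)\in\mathcal E(P),\ p\perp q,\ \iota(p)\cup\iota(q)=[N]\},$$ $$\lambda^+(P)=\min\{N-|\iota(p)\cup\iota(q)| : (N,\iota)\in\mathcal E(P),\ p\perp q,\ \iota(p)\cap\iota(q)=\emptyset\}.$$ *)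

theory Defs
  imports Complex_Main
begin

section \<open>Posets\<close>

text \<open>
  A finite poset is a finite carrier \<open>P\<close> with a reflexive relation \<open>r\<close> such that
  \<open>partial_order_on P r\<close>. This includes \<open>r \<subseteq> P \<times> P\<close>, so the library's strict sections
  \<open>aboveS r x\<close> and \<open>underS r x\<close> are the sets $U_P(x)$ and $D_P(x)$.
\<close>

definition finite_poset :: "'a set \<Rightarrow> 'a rel \<Rightarrow> bool" where
  "finite_poset P r \<longleftrightarrow> finite P \<and> partial_order_on P r"

definition is_antichain :: "'a set \<Rightarrow> 'a rel \<Rightarrow> bool" where
  "is_antichain P r \<longleftrightarrow> (\<forall>p\<in>P. \<forall>q\<in>P. (p, q) \<in> r \<longrightarrow> p = q)"

definition incomparable :: "'a set \<Rightarrow> 'a rel \<Rightarrow> 'a \<Rightarrow> 'a \<Rightarrow> bool" where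
  "incomparable P r p q \<longleftrightarrow> p \<in> P \<and> q \<in> P \<and> (p, q) \<notin> r \<and> (q, p) \<notin> r"

definition has_largest :: "'a set \<Rightarrow> 'a rel \<Rightarrow> bool" where
  "has_largest P r \<longleftrightarrow> (\<exists>m\<in>P. \<forall>x\<in>P. (x, m) \<in> r)"

definition has_smallest :: "'a set \<Rightarrow> 'a rel \<Rightarrow> bool" where
  "has_smallest P r \<longleftrightarrow> (\<exists>m\<in>P. \<forall>x\<in>P. (m, x) \<in> r)"

text \<open>The predicates on pairs below are only ever applied to incomparable pairs.\<close>

definition strong_upper_bad :: "'a set \<Rightarrow> 'a rel \<Rightarrow> 'a \<Rightarrow> 'a \<Rightarrow> bool" where
  "strong_upper_bad P r p q \<longleftrightarrow>
     card (aboveS r p \<inter> aboveS r q) \<ge> 2 \<or>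
     card (aboveS r p \<inter> aboveS r q) = 1 \<and> \<not> has_largest P r"

definition strong_lower_bad :: "'a set \<Rightarrow> 'a rel \<Rightarrow> 'a \<Rightarrow> 'a \<Rightarrow> bool" where
  "strong_lower_bad P r p q \<longleftrightarrow>
     card (underS r p \<inter> underS r q) \<ge> 2 \<or>
     card (underS r p \<inter> underS r q) = 1 \<and> \<not> has_smallest P r"

definition strong_bad :: "'a set \<Rightarrow> 'a rel \<Rightarrow> 'a \<Rightarrow> 'a \<Rightarrow> bool" where
  "strong_bad P r p q \<longleftrightarrow> strong_upper_bad P r p q \<or> strong_lower_bad P r p q"

definition incomparable_good :: "'a set \<Rightarrow> 'a rel \<Rightarrow> bool" where
  "incomparable_good P r \<longleftrightarrow> (\<exists>p q. incomparable P r p q \<and> \<not> strong_bad P r p q)"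

definition incomparable_upper_bad :: "'a set \<Rightarrow> 'a rel \<Rightarrow> bool" where
  "incomparable_upper_bad P r \<longleftrightarrow>
     (\<forall>p q. incomparable P r p q \<longrightarrow> strong_upper_bad P r p q)"

definition incomparable_lower_bad :: "'a set \<Rightarrow> 'a rel \<Rightarrow> bool" where
  "incomparable_lower_bad P r \<longleftrightarrow>
     (\<forall>p q. incomparable P r p q \<longrightarrow> strong_lower_bad P r p q)"

definition incomparable_mixed_bad :: "'a set \<Rightarrow> 'a rel \<Rightarrow> bool" where
  "incomparable_mixed_bad P r \<longleftrightarrow>
     (\<forall>p q. incomparable P r p q \<longrightarrow> strong_bad P r p q) \<and>
     \<not> incomparable_upper_bad P r \<and> \<not> incomparable_lower_bad P r"

section \<open>Strong embeddings and strong copies\<close>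

definition strong_embedding :: "'a set \<Rightarrow> 'a rel \<Rightarrow> nat \<Rightarrow> ('a \<Rightarrow> nat set) \<Rightarrow> bool" where
  "strong_embedding P r N \<iota> \<longleftrightarrow>
     \<iota> ` P \<subseteq> Pow {1..N} \<and> inj_on \<iota> P \<and>
     (\<forall>p\<in>P. \<forall>q\<in>P. (p, q) \<in> r \<longleftrightarrow> \<iota> p \<subseteq> \<iota> q)"

definition strong_copy :: "'a set \<Rightarrow> 'a rel \<Rightarrow> 'b set set \<Rightarrow> bool" where
  "strong_copy P r \<G> \<longleftrightarrow>
     (\<exists>\<iota>. bij_betw \<iota> P \<G> \<and> (\<forall>p\<in>P. \<forall>q\<in>P. (p, q) \<in> r \<longleftrightarrow> \<iota> p \<subseteq> \<iota> q))"

definition strong_embeddings :: "'a set \<Rightarrow> 'a rel \<Rightarrow> (nat \<times> ('a \<Rightarrow> nat set)) set" where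
  "strong_embeddings P r = {(N, \<iota>). N > 0 \<and> strong_embedding P r N \<iota>}"

text \<open>
  The three minima are written with \<open>Inf\<close> on \<^typ>\<open>nat\<close>, which is the least element of a nonempty
  set (the sets here may be infinite, so \<open>Min\<close> is not available). The set for \<open>\<sigma>\<close> is nonempty
  for every finite poset that is not an antichain (embed by principal down-sets). Those for
  \<open>\<lambda>\<close> are nonempty for incomparable mixed bad posets: there is an incomparable pair \<open>p\<close>, \<open>q\<close> that
  is not strong upper bad, and \<open>x \<mapsto> P - {y. (x, y) \<in> r}\<close>, restricted to the elements
  outside \<open>aboveS r p \<inter> aboveS r q\<close> (which is empty or consists of the largest element), gives an
  embedding in which \<open>p\<close>, \<open>q\<close> cover the ground set; dually for \<open>\<lambda>\<close> plus.
\<close>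

definition sigma :: "'a set \<Rightarrow> 'a rel \<Rightarrow> nat" where
  "sigma P r = Inf {card (\<iota> q - \<iota> p) | N \<iota> p q.
     (N, \<iota>) \<in> strong_embeddings P r \<and> p \<in> P \<and> q \<in> P \<and> (p, q) \<in> r \<and> p \<noteq> q}"

definition lambda_minus :: "'a set \<Rightarrow> 'a rel \<Rightarrow> nat" where
  "lambda_minus P r = Inf {card (\<iota> p \<inter> \<iota> q) | N \<iota> p q.
     (N, \<iota>) \<in> strong_embeddings P r \<and> incomparable P r p q \<and> \<iota> p \<union> \<iota> q = {1..N}}"

definition lambda_plus :: "'a set \<Rightarrow> 'a rel \<Rightarrow> nat" where
  "lambda_plus P r = Inf {N - card (\<iota> p \<union> \<iota> q) | N \<iota> p q.
     (N, \<iota>) \<in> strong_embeddings P r \<and> incomparable P r p q \<and> \<iota> p \<inter> \<iota> q = {}}"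

section \<open>Graphs\<close>

text \<open>A simple graph is a pair of a vertex set and a set of two-element edges.\<close>

type_synonym 'v graph = "'v set \<times> 'v set set"

definition induced_subgraph :: "'v graph \<Rightarrow> 'v set \<Rightarrow> 'v graph" where
  "induced_subgraph G W = (fst G \<inter> W, {e \<in> snd G. e \<subseteq> W})"

definition independent_set :: "'v graph \<Rightarrow> 'v set \<Rightarrow> bool" where
  "independent_set G S \<longleftrightarrow> S \<subseteq> fst G \<and> (\<forall>u\<in>S. \<forall>v\<in>S. {u, v} \<notin> snd G)"

definition independence_number :: "'v graph \<Rightarrow> nat" where
  "independence_number G = Max {card S | S. independent_set G S}"

definition copy_graph :: "'a set \<Rightarrow> 'a rel \<Rightarrow> nat \<Rightarrow> nat set graph" where
  "copy_graph P r n =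
     (Pow {1..n},
      {{F, G} | F G. F \<noteq> G \<and> (\<exists>\<G> \<subseteq> Pow {1..n}. strong_copy P r \<G> \<and> F \<in> \<G> \<and> G \<in> \<G>)})"

definition middle_layers :: "nat \<Rightarrow> nat set set" where
  "middle_layers n =
     {F. F \<subseteq> {1..n} \<and> \<bar>real (card F) - real n / 2\<bar> \<le> real n powr (2 / 3)}"

definition middle_copy_graph :: "'a set \<Rightarrow> 'a rel \<Rightarrow> nat \<Rightarrow> nat set graph" where
  "middle_copy_graph P r n = induced_subgraph (copy_graph P r n) (middle_layers n)"

end

theory Submission
  imports Defs
begin

text \<open>
  A strong embedding of \<open>P\<close> into the subsets of \<open>{1..N}\<close> amounts to a list of \<open>N\<close> up-sets of
  \<open>P\<close>, one per coordinate, that separates \<open>x\<close> from \<open>y\<close> whenever \<open>(x, y) \<notin> r\<close>. Repeating up-sets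
  and inserting further ones keeps the list separating. So two given sets \<open>F\<close>, \<open>G\<close> are the images
  of two given elements \<open>p\<close>, \<open>q\<close> as soon as each of the four Venn regions of \<open>F\<close> and \<open>G\<close> has room
  for the up-sets of a separating family that have the corresponding trace on \<open>{p, q}\<close>; this is
  \<open>exists_embedding_of_separating\<close>. A family has at most \<open>2 ^ card P\<close> members, so a region
  with that many elements imposes no condition at all.

  For sets in the middle layers this leaves few obstructions to adjacency.

  \<^item> \<open>F \<subset> G\<close>: the regions \<open>F\<close> and \<open>{1..n} - G\<close> are large, so \<open>F\<close> and \<open>G\<close> are adjacent iff
    \<open>card (G - F) \<ge> sigma P r\<close>.

  \<^item> \<open>F\<close>, \<open>G\<close> incomparable, with intersection and outside both large: the sets are adjacent. An
    incomparable pair placed as high as possible in \<open>P\<close> has \<open>aboveS r p = aboveS r q\<close>, and then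
    only one up-set of a suitable family contains \<open>p\<close> and not \<open>q\<close>, and only one \<open>q\<close> and not \<open>p\<close>.

  \<^item> \<open>F\<close>, \<open>G\<close> incomparable and not adjacent: now \<open>F\<close> is almost the complement of \<open>G\<close>, so both
    differences are large. The up-sets containing exactly one element of a good pair already
    separate, so for good \<open>P\<close> this case does not occur. For mixed bad \<open>P\<close> it forces
    \<open>card (F \<inter> G) < lambda_minus P r\<close> and \<open>n - card (F \<union> G) < lambda_plus P r\<close>.

  Consequently, within an independent set, comparable sets are close and incomparable ones are
  nearly complementary. Closeness is transitive and three sets cannot be pairwise nearly
  complementary, so comparability is an equivalence relation with at most two classes, and each
  class is a chain of at most \<open>sigma P r\<close> sets. If there are two classes, the sizes of their least
  and greatest members are tied together by the two bounds with \<open>lambda\<close>, which bounds the total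
  by \<open>lambda_minus P r + lambda_plus P r\<close>. If \<open>P\<close> is upper or lower bad, \<open>sigma P r = 1\<close>.

  The bounds are attained by initial segments \<open>{1..a}\<close> together with final segments \<open>{b..n}\<close>. Such
  a pair is either disjoint or covers \<open>{1..n}\<close>, and these are exactly the situations that the
  definitions of \<open>lambda_plus\<close> and \<open>lambda_minus\<close> speak about.

  That \<open>sigma\<close> is unbounded on good posets is witnessed by crowns.
\<close>

section \<open>Strong embeddings as separating families of up-sets\<close>

definition upset :: "'a set \<Rightarrow> 'a rel \<Rightarrow> 'a set \<Rightarrow> bool" where
  "upset P r U \<longleftrightarrow> U \<subseteq> P \<and> (\<forall>x\<in>U. \<forall>y. (x, y) \<in> r \<longrightarrow> y \<in> U)"

definition separating :: "'a set \<Rightarrow> 'a rel \<Rightarrow> 'a set set \<Rightarrow> bool" where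
  "separating P r \<U> \<longleftrightarrow> (\<forall>U\<in>\<U>. upset P r U) \<and>
     (\<forall>x\<in>P. \<forall>y\<in>P. (x, y) \<notin> r \<longrightarrow> (\<exists>U\<in>\<U>. x \<in> U \<and> y \<notin> U))"

text \<open>
  The up-sets \<open>non_below P r y\<close>, for \<open>y \<in> P\<close>, form a separating family that suits pairs with the
  same upper bounds: the trace of \<open>non_below P r y\<close> on \<open>{p, q}\<close> depends only on which of \<open>p\<close>, \<open>q\<close>
  lie below \<open>y\<close>.
\<close>

definition non_below :: "'a set \<Rightarrow> 'a rel \<Rightarrow> 'a \<Rightarrow> 'a set" where
  "non_below P r y = {x \<in> P. (x, y) \<notin> r}"

definition coordinate_upsets :: "'a set \<Rightarrow> nat \<Rightarrow> ('a \<Rightarrow> nat set) \<Rightarrow> 'a set set" where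
  "coordinate_upsets P N \<iota> = (\<lambda>j. {x \<in> P. j \<in> \<iota> x}) ` {1..N}"

definition copy_adjacent :: "'a set \<Rightarrow> 'a rel \<Rightarrow> nat \<Rightarrow> nat set \<Rightarrow> nat set \<Rightarrow> bool" where
  "copy_adjacent P r n F G \<longleftrightarrow> (\<exists>\<iota>. strong_embedding P r n \<iota> \<and> F \<in> \<iota> ` P \<and> G \<in> \<iota> ` P)"

lemma exists_map_covering:
  assumes "finite A" "finite B" "card B \<le> card A"
  shows "\<exists>f. B \<subseteq> f ` A \<and> f ` A \<subseteq> insert d B"
proof -
  obtain g where g: "inj_on g B" "g ` B \<subseteq> A"
    using assms card_le_inj[OF assms(2,1,3)] by auto
  define f where "f a = (if a \<in> g ` B then inv_into B g a else d)" for a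
  have "f (g b) = b" if "b \<in> B" for b
    using that g by (auto simp: f_def)
  then have "B \<subseteq> f ` A"
    using g by force
  moreover have "f ` A \<subseteq> insert d B"
    by (auto simp: f_def inv_into_into)
  ultimately show ?thesis by blast
qed

lemma separating_subset_Pow: "separating P r \<U> \<Longrightarrow> \<U> \<subseteq> Pow P"
  by (auto simp: separating_def upset_def)

lemma card_separating_le:
  assumes "finite P" "separating P r \<U>"
  shows "card {U \<in> \<U>. Q U} \<le> 2 ^ card P"
proof -
  have "card {U \<in> \<U>. Q U} \<le> card (Pow P)"
    using separating_subset_Pow[OF assms(2)] assms(1) by (intro card_mono) auto
  then show ?thesis using assms(1) by (simp add: card_Pow)
qed

text \<open>
  Strong copies and strong embeddings into the subsets of \<open>{1..n}\<close> are the same thing, so from here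
  on the graph is replaced by the relation \<open>copy_adjacent\<close>.
\<close>

lemma copy_graph_edge_iff:
  "{F, G} \<in> snd (copy_graph P r n) \<longleftrightarrow> F \<noteq> G \<and> copy_adjacent P r n F G"
proof
  assume "{F, G} \<in> snd (copy_graph P r n)"
  then obtain F' G' \<G> where h: "{F, G} = {F', G'}" "F' \<noteq> G'" "\<G> \<subseteq> Pow {1..n}"
      "strong_copy P r \<G>" "F' \<in> \<G>" "G' \<in> \<G>"
    unfolding copy_graph_def by auto
  then have FG: "F \<noteq> G" "F \<in> \<G>" "G \<in> \<G>" by (auto simp: doubleton_eq_iff)
  obtain \<iota> where "bij_betw \<iota> P \<G>" "\<forall>p\<in>P. \<forall>q\<in>P. (p, q) \<in> r \<longleftrightarrow> \<iota> p \<subseteq> \<iota> q"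
    using h(4) by (auto simp: strong_copy_def)
  then have "strong_embedding P r n \<iota>" "\<iota> ` P = \<G>"
    using h(3) by (auto simp: strong_embedding_def bij_betw_def)
  then show "F \<noteq> G \<and> copy_adjacent P r n F G"
    using FG unfolding copy_adjacent_def by blast
next
  assume a: "F \<noteq> G \<and> copy_adjacent P r n F G"
  then obtain \<iota> where i: "strong_embedding P r n \<iota>" "F \<in> \<iota> ` P" "G \<in> \<iota> ` P"
    by (auto simp: copy_adjacent_def)
  then have "strong_copy P r (\<iota> ` P)" "\<iota> ` P \<subseteq> Pow {1..n}"
    by (auto simp: strong_copy_def strong_embedding_def bij_betw_def)
  then show "{F, G} \<in> snd (copy_graph P r n)"
    using a i(2,3) unfolding copy_graph_def snd_conv by blast
qed

lemma independent_middle_iff: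
  "independent_set (middle_copy_graph P r n) S \<longleftrightarrow>
     S \<subseteq> middle_layers n \<and> (\<forall>F\<in>S. \<forall>G\<in>S. F \<noteq> G \<longrightarrow> \<not> copy_adjacent P r n F G)"
proof -
  have v: "fst (middle_copy_graph P r n) = middle_layers n"
    by (auto simp: middle_copy_graph_def induced_subgraph_def copy_graph_def middle_layers_def)
  have e: "{F, G} \<in> snd (middle_copy_graph P r n) \<longleftrightarrow>
      F \<noteq> G \<and> copy_adjacent P r n F G \<and> F \<in> middle_layers n \<and> G \<in> middle_layers n" for F G
    by (auto simp: middle_copy_graph_def induced_subgraph_def copy_graph_edge_iff)
  show ?thesis
    unfolding independent_set_def v e by blast
qed

locale poset_carrier =
  fixes P :: "'a set" and r :: "'a rel"
  assumes finite_poset: "finite_poset P r"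
begin

lemma finite_carrier: "finite P"
  using finite_poset by (simp add: finite_poset_def)

lemma le_refl: "x \<in> P \<Longrightarrow> (x, x) \<in> r"
  using finite_poset by (auto simp: finite_poset_def partial_order_on_def preorder_on_def refl_on_def)

lemma le_carrier: "(x, y) \<in> r \<Longrightarrow> x \<in> P \<and> y \<in> P"
  using finite_poset by (auto simp: finite_poset_def partial_order_on_def preorder_on_def refl_on_def)

lemma le_trans: "(x, y) \<in> r \<Longrightarrow> (y, z) \<in> r \<Longrightarrow> (x, z) \<in> r"
  using finite_poset
  by (auto simp: finite_poset_def partial_order_on_def preorder_on_def dest: transD)

lemma le_antisym: "(x, y) \<in> r \<Longrightarrow> (y, x) \<in> r \<Longrightarrow> x = y"
  using finite_poset
  by (auto simp: finite_poset_def partial_order_on_def dest: antisymD)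

lemma dual: "poset_carrier P (r\<inverse>)"
  using finite_poset by unfold_locales (simp add: finite_poset_def)

text \<open>
  Sort the elements of \<open>{1..n}\<close> into the four Venn regions of \<open>F\<close> and \<open>G\<close>, and the members of \<open>\<U>\<close>
  into four types by their trace on \<open>{p, q}\<close>. Each region is mapped onto the up-sets of its type;
  surplus elements go to a default up-set of the same type: \<open>P\<close>, a principal up-set, or the empty
  set. The last two hypotheses say that the principal up-set of \<open>p\<close> (of \<open>q\<close>) has the right trace
  when it is needed. Reading the map coordinatewise gives the embedding.
\<close>

lemma exists_embedding_of_separating:
  assumes sep: "separating P r \<U>" and p: "p \<in> P" and q: "q \<in> P"
    and F: "F \<subseteq> {1..n}" and G: "G \<subseteq> {1..n}"
    and tt: "card {U \<in> \<U>. p \<in> U \<and> q \<in> U} \<le> card (F \<inter> G)"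
    and tf: "card {U \<in> \<U>. p \<in> U \<and> q \<notin> U} \<le> card (F - G)"
    and ft: "card {U \<in> \<U>. p \<notin> U \<and> q \<in> U} \<le> card (G - F)"
    and ff: "card {U \<in> \<U>. p \<notin> U \<and> q \<notin> U} \<le> n - card (F \<union> G)"
    and dtf: "F - G \<noteq> {} \<Longrightarrow> (p, q) \<notin> r" and dft: "G - F \<noteq> {} \<Longrightarrow> (q, p) \<notin> r"
  shows "\<exists>\<iota>. strong_embedding P r n \<iota> \<and> \<iota> p = F \<and> \<iota> q = G"
proof -
  define A where "A s t = {i \<in> {1..n}. (i \<in> F) = s \<and> (i \<in> G) = t}" for s t
  define B where "B s t = {U \<in> \<U>. (p \<in> U) = s \<and> (q \<in> U) = t}" for s t
  have fin: "finite \<U>"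
    using separating_subset_Pow[OF sep] finite_carrier finite_subset by blast
  have up: "upset P r U" if "U \<in> \<U>" for U
    using sep that by (auto simp: separating_def)
  have [simp]: "A True True = F \<inter> G" "A True False = F - G" "A False True = G - F"
      "A False False = {1..n} - (F \<union> G)"
    using F G by (auto simp: A_def)
  have "card ({1..n} - (F \<union> G)) = n - card (F \<union> G)"
    using F G by (subst card_Diff_subset) (auto intro: finite_subset)
  then have AB: "card (B s t) \<le> card (A s t)" for s t
    using tt tf ft ff by (cases s; cases t) (auto simp: B_def)
  have "\<exists>f. B s t \<subseteq> f ` A s t \<and>
      (\<forall>i\<in>A s t. upset P r (f i) \<and> (p \<in> f i) = s \<and> (q \<in> f i) = t)" for s t
  proof -
    have "\<exists>d. A s t \<noteq> {} \<longrightarrow> upset P r d \<and> (p \<in> d) = s \<and> (q \<in> d) = t"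
    proof (cases s; cases t)
      assume "s" "t" then show ?thesis
        using p q le_carrier by (intro exI[of _ P]) (auto simp: upset_def)
    next
      assume "s" "\<not> t" then show ?thesis
        using dtf p le_refl le_trans le_carrier
        by (intro exI[of _ "{y. (p, y) \<in> r}"]) (auto simp: upset_def)
    next
      assume "\<not> s" "t" then show ?thesis
        using dft q le_refl le_trans le_carrier
        by (intro exI[of _ "{y. (q, y) \<in> r}"]) (auto simp: upset_def)
    next
      assume "\<not> s" "\<not> t" then show ?thesis
        by (intro exI[of _ "{}"]) (auto simp: upset_def)
    qed
    then obtain d where d: "A s t \<noteq> {} \<longrightarrow> upset P r d \<and> (p \<in> d) = s \<and> (q \<in> d) = t"
      by blast
    obtain f where f: "B s t \<subseteq> f ` A s t" "f ` A s t \<subseteq> insert d (B s t)"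
    proof -
      have "finite (A s t)" "finite (B s t)" using fin by (auto simp: A_def B_def)
      then show thesis using exists_map_covering[OF _ _ AB[of s t]] that by blast
    qed
    have "upset P r (f i) \<and> (p \<in> f i) = s \<and> (q \<in> f i) = t" if "i \<in> A s t" for i
    proof (cases "f i = d")
      case True then show ?thesis using d that by auto
    next
      case False
      then have "f i \<in> B s t" using f(2) that by auto
      then show ?thesis using up by (auto simp: B_def)
    qed
    then show ?thesis using f(1) by blast
  qed
  then obtain f where f: "\<And>s t. B s t \<subseteq> f s t ` A s t"
      "\<And>s t i. i \<in> A s t \<Longrightarrow> upset P r (f s t i) \<and> (p \<in> f s t i) = s \<and> (q \<in> f s t i) = t"
    by metis
  define h where "h i = f (i \<in> F) (i \<in> G) i" for i
  have h: "upset P r (h i)" "(p \<in> h i) = (i \<in> F)" "(q \<in> h i) = (i \<in> G)" if "i \<in> {1..n}" for i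
    using f(2)[of i "i \<in> F" "i \<in> G"] that by (auto simp: A_def h_def)
  have cover: "\<exists>i\<in>{1..n}. h i = U" if "U \<in> \<U>" for U
  proof -
    have "U \<in> B (p \<in> U) (q \<in> U)" using that by (simp add: B_def)
    then obtain i where "i \<in> A (p \<in> U) (q \<in> U)" "U = f (p \<in> U) (q \<in> U) i"
      using f(1) by blast
    then show ?thesis by (intro bexI[of _ i]) (auto simp: A_def h_def)
  qed
  define \<iota> where "\<iota> x = {i \<in> {1..n}. x \<in> h i}" for x
  have order: "(x, y) \<in> r \<longleftrightarrow> \<iota> x \<subseteq> \<iota> y" if xy: "x \<in> P" "y \<in> P" for x y
  proof
    show "(x, y) \<in> r \<Longrightarrow> \<iota> x \<subseteq> \<iota> y"
      using h(1) by (auto simp: \<iota>_def upset_def)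
    show "(x, y) \<in> r" if sub: "\<iota> x \<subseteq> \<iota> y"
    proof (rule ccontr)
      assume "(x, y) \<notin> r"
      then obtain U where "U \<in> \<U>" "x \<in> U" "y \<notin> U"
        using sep xy unfolding separating_def by blast
      with cover[of U] sub show False by (auto simp: \<iota>_def)
    qed
  qed
  have "inj_on \<iota> P"
    using order le_antisym by (intro inj_onI) auto
  then have "strong_embedding P r n \<iota>"
    using order by (auto simp: strong_embedding_def \<iota>_def)
  moreover have "\<iota> p = F" "\<iota> q = G"
    using h F G by (auto simp: \<iota>_def)
  ultimately show ?thesis by blast
qed

text \<open>
  The converse direction: an embedding is recovered from the up-sets of its coordinates. Together
  with the count below, this allows an embedding into a small cube to be transplanted onto
  prescribed sets \<open>F\<close> and \<open>G\<close>.
\<close>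

lemma separating_coordinate_upsets:
  assumes "strong_embedding P r N \<iota>"
  shows "separating P r (coordinate_upsets P N \<iota>)"
proof -
  have "upset P r {x \<in> P. j \<in> \<iota> x}" for j
    using assms le_carrier unfolding upset_def strong_embedding_def by blast
  moreover have "\<exists>U\<in>coordinate_upsets P N \<iota>. x \<in> U \<and> y \<notin> U"
    if "x \<in> P" "y \<in> P" "(x, y) \<notin> r" for x y
  proof -
    have "\<not> \<iota> x \<subseteq> \<iota> y" "\<iota> x \<subseteq> {1..N}"
      using assms that by (auto simp: strong_embedding_def)
    then obtain j where "j \<in> \<iota> x" "j \<notin> \<iota> y" "j \<in> {1..N}" by blast
    then show ?thesis
      using that unfolding coordinate_upsets_def by (intro bexI[of _ "{x \<in> P. j \<in> \<iota> x}"]) auto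
  qed
  ultimately show ?thesis by (auto simp: separating_def coordinate_upsets_def)
qed

lemma card_coordinate_upsets_le:
  "card {U \<in> coordinate_upsets P N \<iota>. Q U} \<le> card {j \<in> {1..N}. Q {x \<in> P. j \<in> \<iota> x}}"
proof -
  have "{U \<in> coordinate_upsets P N \<iota>. Q U}
      = (\<lambda>j. {x \<in> P. j \<in> \<iota> x}) ` {j \<in> {1..N}. Q {x \<in> P. j \<in> \<iota> x}}"
    by (auto simp: coordinate_upsets_def)
  then show ?thesis by (simp add: card_image_le)
qed

lemma upset_non_below: "upset P r (non_below P r y)"
  using le_trans le_carrier unfolding upset_def non_below_def by blast

lemma separating_non_below: "separating P r (non_below P r ` P)"
  using upset_non_below le_refl unfolding separating_def by (auto simp: non_below_def)

section \<open>Comparable sets\<close>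

lemma embedding_positive:
  assumes "strong_embedding P r N \<iota>" "p \<in> P" "q \<in> P" "p \<noteq> q"
  shows "N > 0"
proof (rule ccontr)
  assume "\<not> N > 0"
  then have "\<iota> p = \<iota> q" using assms by (auto simp: strong_embedding_def)
  then show False using assms by (auto simp: strong_embedding_def dest: inj_onD)
qed

lemma sigma_le:
  assumes "strong_embedding P r N \<iota>" "(p, q) \<in> r" "p \<noteq> q"
  shows "sigma P r \<le> card (\<iota> q - \<iota> p)"
proof -
  have "p \<in> P" "q \<in> P" using le_carrier assms by auto
  then have "(N, \<iota>) \<in> strong_embeddings P r"
    using assms(1,3) embedding_positive by (auto simp: strong_embeddings_def)
  then show ?thesis
    unfolding sigma_def using assms \<open>p \<in> P\<close> \<open>q \<in> P\<close> by (intro wellorder_Inf_le1) blast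
qed

text \<open>
  The point is that the set in the definition of \<open>sigma\<close> is nonempty; any separating family gives
  a member, if all regions except the empty \<open>F - G\<close> are given ample room.
\<close>

lemma sigma_attained:
  assumes "\<not> is_antichain P r"
  shows "\<exists>N \<iota> p q. strong_embedding P r N \<iota> \<and> (p, q) \<in> r \<and> p \<noteq> q \<and> card (\<iota> q - \<iota> p) = sigma P r"
proof -
  obtain p q where pq: "(p, q) \<in> r" "p \<noteq> q" "p \<in> P" "q \<in> P"
    using assms by (auto simp: is_antichain_def)
  define K where "K = (2::nat) ^ card P"
  have tf: "{U \<in> non_below P r ` P. p \<in> U \<and> q \<notin> U} = {}"
    using upset_non_below pq by (auto simp: upset_def)
  let ?F = "{1..K}" and ?G = "{1..2 * K}"
  have sets: "?F \<inter> ?G = ?F" "?F - ?G = {}" "?G - ?F = {K + 1..2 * K}" "?F \<union> ?G = ?G"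
    by auto
  have small: "card {U \<in> non_below P r ` P. Q U} \<le> K" for Q
    using card_separating_le[OF finite_carrier separating_non_below] by (simp add: K_def)
  have "(q, p) \<notin> r" using pq le_antisym by auto
  then have "\<exists>\<iota>. strong_embedding P r (3 * K) \<iota> \<and> \<iota> p = ?F \<and> \<iota> q = ?G"
    by (intro exists_embedding_of_separating[OF separating_non_below], unfold sets tf)
       (use pq small in auto)
  then obtain \<iota> where i: "strong_embedding P r (3 * K) \<iota>" by blast
  then have "(3 * K, \<iota>) \<in> strong_embeddings P r"
    using embedding_positive[OF i pq(3,4,2)] by (auto simp: strong_embeddings_def)
  then have "sigma P r \<in> {card (\<iota> q - \<iota> p) | N \<iota> p q.
     (N, \<iota>) \<in> strong_embeddings P r \<and> p \<in> P \<and> q \<in> P \<and> (p, q) \<in> r \<and> p \<noteq> q}"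
    unfolding sigma_def using pq by (intro wellorder_InfI[of "card (\<iota> q - \<iota> p)"]) blast
  then show ?thesis unfolding strong_embeddings_def mem_Collect_eq case_prod_conv by metis
qed

lemma sigma_pos:
  assumes "\<not> is_antichain P r"
  shows "sigma P r \<ge> 1"
proof -
  obtain N \<iota> p q where h: "strong_embedding P r N \<iota>" "(p, q) \<in> r" "p \<noteq> q"
      "card (\<iota> q - \<iota> p) = sigma P r"
    using sigma_attained[OF assms] by blast
  have "p \<in> P" "q \<in> P" "(q, p) \<notin> r" using h le_carrier le_antisym by auto
  then have "\<iota> q - \<iota> p \<noteq> {}" "finite (\<iota> q)"
    using h(1) by (auto simp: strong_embedding_def intro: finite_subset)
  then have "card (\<iota> q - \<iota> p) > 0" by (simp add: card_gt_0_iff)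
  then show ?thesis using h by simp
qed

text \<open>
  Transplant an embedding that attains \<open>sigma\<close>: the only region whose size matters is \<open>G - F\<close>.
\<close>

lemma comparable_adjacent:
  assumes na: "\<not> is_antichain P r" and FG: "F \<subseteq> G" "G \<subseteq> {1..n}"
    and big: "2 ^ card P \<le> card F" "2 ^ card P \<le> n - card G" "sigma P r \<le> card (G - F)"
  shows "copy_adjacent P r n F G"
proof -
  obtain N \<iota> p q where h: "strong_embedding P r N \<iota>" "(p, q) \<in> r" "p \<noteq> q"
      "card (\<iota> q - \<iota> p) = sigma P r"
    using sigma_attained[OF na] by blast
  have pq: "p \<in> P" "q \<in> P" using h(2) le_carrier by auto
  let ?U = "coordinate_upsets P N \<iota>"
  note sep = separating_coordinate_upsets[OF h(1)]
  have "p \<notin> U" if "q \<notin> U" "U \<in> ?U" for U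
    using sep that h(2) by (auto simp: separating_def upset_def)
  then have tf: "{U \<in> ?U. p \<in> U \<and> q \<notin> U} = {}" by blast
  have "\<iota> q \<subseteq> {1..N}" using h(1) pq unfolding strong_embedding_def by blast
  then have "{j \<in> {1..N}. j \<notin> \<iota> p \<and> j \<in> \<iota> q} = \<iota> q - \<iota> p" by blast
  then have ft: "card {U \<in> ?U. p \<notin> U \<and> q \<in> U} \<le> card (G - F)"
    using card_coordinate_upsets_le[of N \<iota> "\<lambda>U. p \<notin> U \<and> q \<in> U"] pq h(4) big(3) by simp
  have fs: "F \<inter> G = F" "F - G = {}" "F \<union> G = G" using FG by auto
  note small = order.trans[OF card_separating_le[OF finite_carrier sep] big(1)]
    order.trans[OF card_separating_le[OF finite_carrier sep] big(2)]
  have "(q, p) \<notin> r" using h le_antisym by auto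
  then have "\<exists>\<iota>. strong_embedding P r n \<iota> \<and> \<iota> p = F \<and> \<iota> q = G"
    using FG by (intro exists_embedding_of_separating[OF sep pq], unfold fs tf)
      (use ft small in auto)
  then show ?thesis using pq by (auto simp: copy_adjacent_def)
qed

lemma sigma_le_of_comparable_adjacent:
  assumes "F \<subset> G" "copy_adjacent P r n F G"
  shows "sigma P r \<le> card (G - F)"
proof -
  obtain \<iota> p q where h: "strong_embedding P r n \<iota>" "p \<in> P" "q \<in> P" "F = \<iota> p" "G = \<iota> q"
    using assms(2) by (auto simp: copy_adjacent_def)
  then have "(p, q) \<in> r" "p \<noteq> q"
    using assms(1) by (auto simp: strong_embedding_def)
  then show ?thesis using sigma_le h by auto
qed

section \<open>Incomparable sets\<close>

lemma aboveS_subset: "aboveS r x \<subseteq> P"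
  using le_carrier by (auto simp: aboveS_def)

lemma card_aboveS_less:
  assumes "y \<in> aboveS r x"
  shows "card (aboveS r y) < card (aboveS r x)"
proof (rule psubset_card_mono)
  show "finite (aboveS r x)" using aboveS_subset finite_carrier finite_subset by blast
  show "aboveS r y \<subset> aboveS r x"
    using assms le_trans le_antisym unfolding aboveS_def by blast
qed

lemma incomparable_adjacentE:
  assumes "copy_adjacent P r n F G" "\<not> F \<subseteq> G" "\<not> G \<subseteq> F"
  obtains \<iota> p q where "strong_embedding P r n \<iota>" "incomparable P r p q" "\<iota> p = F" "\<iota> q = G"
proof -
  obtain \<iota> p q where h: "strong_embedding P r n \<iota>" "p \<in> P" "q \<in> P" "F = \<iota> p" "G = \<iota> q"
    using assms(1) by (auto simp: copy_adjacent_def)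
  then have "incomparable P r p q"
    using assms by (auto simp: incomparable_def strong_embedding_def)
  then show thesis using that h by auto
qed

text \<open>
  Take an incomparable pair that minimises \<open>card (aboveS r p) + card (aboveS r q)\<close>. Going up strictly
  shrinks \<open>aboveS\<close>, so any incomparable pair obtained by moving \<open>p\<close> or \<open>q\<close> up, or both, would be
  smaller. An \<open>x\<close> above \<open>p\<close> but not above \<open>q\<close> would be incomparable to \<open>q\<close>, and two incomparable
  common upper bounds would form such a pair as well.
\<close>

lemma top_incomparable_pair:
  assumes "\<not> total_on P r"
  obtains p q where "incomparable P r p q" "aboveS r p = aboveS r q"
    "\<forall>x\<in>aboveS r p. \<forall>y\<in>aboveS r p. (x, y) \<in> r \<or> (y, x) \<in> r"
proof -
  let ?m = "\<lambda>(p, q). card (aboveS r p) + card (aboveS r q)"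
  let ?I = "\<lambda>(p, q). incomparable P r p q"
  have "\<exists>z. ?I z" using assms by (auto simp: total_on_def incomparable_def)
  then obtain z where "?I z" "\<forall>w. ?I w \<longrightarrow> ?m z \<le> ?m w"
    using ex_has_least_nat[of ?I _ ?m] by metis
  moreover obtain p q where "z = (p, q)" by (cases z)
  ultimately have pq: "incomparable P r p q"
    and least: "\<And>p' q'. incomparable P r p' q' \<Longrightarrow>
      card (aboveS r p) + card (aboveS r q) \<le> card (aboveS r p') + card (aboveS r q')"
    by auto
  have 1: "x \<in> aboveS r q" if "x \<in> aboveS r p" for x
  proof (rule ccontr)
    assume "x \<notin> aboveS r q"
    then have "incomparable P r x q"
      using that pq le_trans le_carrier le_refl unfolding aboveS_def incomparable_def by blast
    then show False using least card_aboveS_less[OF that] by fastforce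
  qed
  have 2: "x \<in> aboveS r p" if "x \<in> aboveS r q" for x
  proof (rule ccontr)
    assume "x \<notin> aboveS r p"
    then have "incomparable P r p x"
      using that pq le_trans le_carrier le_refl unfolding aboveS_def incomparable_def by blast
    then show False using least card_aboveS_less[OF that] by fastforce
  qed
  have "(x, y) \<in> r \<or> (y, x) \<in> r" if x: "x \<in> aboveS r p" and y: "y \<in> aboveS r p" for x y
  proof (rule ccontr)
    assume "\<not> ((x, y) \<in> r \<or> (y, x) \<in> r)"
    then have "incomparable P r x y"
      using x y aboveS_subset by (auto simp: incomparable_def)
    then show False
      using least card_aboveS_less[OF x] card_aboveS_less[OF 1[OF y]] by fastforce
  qed
  then show thesis using that pq 1 2 by blast
qed

text \<open>
  For a topmost pair, \<open>non_below P r y\<close> distinguishes \<open>p\<close> from \<open>q\<close> only if \<open>y\<close> is \<open>p\<close> or \<open>q\<close>, so the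
  two differences \<open>F - G\<close> and \<open>G - F\<close> only need to be nonempty.
\<close>

lemma incomparable_adjacent_middle:
  assumes nt: "\<not> total_on P r" and FG: "F \<subseteq> {1..n}" "G \<subseteq> {1..n}" "\<not> F \<subseteq> G" "\<not> G \<subseteq> F"
    and big: "2 ^ card P \<le> card (F \<inter> G)" "2 ^ card P \<le> n - card (F \<union> G)"
  shows "copy_adjacent P r n F G"
proof -
  obtain p q where pq: "incomparable P r p q" "aboveS r p = aboveS r q"
    using top_incomparable_pair[OF nt] by metis
  then have c: "p \<in> P" "q \<in> P" "(p, q) \<notin> r" "(q, p) \<notin> r" by (auto simp: incomparable_def)
  let ?U = "non_below P r ` P"
  have ab: "(p, y) \<in> r \<longleftrightarrow> (q, y) \<in> r" if "y \<noteq> p" "y \<noteq> q" for y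
    using pq(2) that unfolding aboveS_def by blast
  have "y = q" if "p \<in> non_below P r y" "q \<notin> non_below P r y" for y
    using that ab[of y] c by (auto simp: non_below_def)
  then have sub1: "{U \<in> ?U. p \<in> U \<and> q \<notin> U} \<subseteq> {non_below P r q}" by blast
  have "y = p" if "p \<notin> non_below P r y" "q \<in> non_below P r y" for y
    using that ab[of y] c by (auto simp: non_below_def)
  then have sub2: "{U \<in> ?U. p \<notin> U \<and> q \<in> U} \<subseteq> {non_below P r p}" by blast
  have le1: "card {U \<in> ?U. p \<in> U \<and> q \<notin> U} \<le> 1" "card {U \<in> ?U. p \<notin> U \<and> q \<in> U} \<le> 1"
    using card_mono[OF _ sub1] card_mono[OF _ sub2] by simp_all
  have "finite F" "finite G" using FG by (auto intro: finite_subset)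
  then have ge1: "1 \<le> card (F - G)" "1 \<le> card (G - F)"
    using FG by (auto simp: Suc_le_eq card_gt_0_iff)
  note small = card_separating_le[OF finite_carrier separating_non_below]
  have "\<exists>\<iota>. strong_embedding P r n \<iota> \<and> \<iota> p = F \<and> \<iota> q = G"
    using c by (intro exists_embedding_of_separating[OF separating_non_below c(1,2) FG(1,2)]
      order.trans[OF small big(1)] order.trans[OF small big(2)]
      order.trans[OF le1(1) ge1(1)] order.trans[OF le1(2) ge1(2)])
  then show ?thesis using c by (auto simp: copy_adjacent_def)
qed

text \<open>
  A form that avoids cardinalities: a pair is strong upper bad iff it has a common upper bound that
  is not the largest element of \<open>P\<close>. This is what an embedding can see, since the image of such an
  upper bound contains \<open>\<iota> p \<union> \<iota> q\<close> and is not the whole ground set.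
\<close>

lemma strong_upper_bad_iff:
  assumes "incomparable P r p q"
  shows "strong_upper_bad P r p q \<longleftrightarrow> (\<exists>y x. (p, y) \<in> r \<and> (q, y) \<in> r \<and> x \<in> P \<and> (x, y) \<notin> r)"
proof -
  let ?A = "aboveS r p \<inter> aboveS r q"
  have fin: "finite ?A" using aboveS_subset finite_carrier by (meson finite_Int finite_subset)
  have A: "y \<in> ?A \<longleftrightarrow> (p, y) \<in> r \<and> (q, y) \<in> r" for y
    using assms by (auto simp: aboveS_def incomparable_def)
  show ?thesis
  proof
    assume bad: "strong_upper_bad P r p q"
    show "\<exists>y x. (p, y) \<in> r \<and> (q, y) \<in> r \<and> x \<in> P \<and> (x, y) \<notin> r"
    proof (rule ccontr)
      assume "\<not> ?thesis"
      then have largest: "(x, y) \<in> r" if "y \<in> ?A" "x \<in> P" for x y using that A by blast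
      have "y = z" if "y \<in> ?A" "z \<in> ?A" for y z
        using largest[OF that(1)] largest[OF that(2)] that le_antisym aboveS_subset by blast
      then have "card ?A \<le> 1" using fin by (auto simp: card_le_Suc0_iff_eq)
      then have "card ?A = 1" "\<not> has_largest P r" using bad by (auto simp: strong_upper_bad_def)
      then obtain y where "y \<in> ?A" by (metis card.empty ex_in_conv zero_neq_one)
      then have "has_largest P r"
        using largest aboveS_subset unfolding has_largest_def by blast
      then show False using \<open>\<not> has_largest P r\<close> by simp
    qed
  next
    assume "\<exists>y x. (p, y) \<in> r \<and> (q, y) \<in> r \<and> x \<in> P \<and> (x, y) \<notin> r"
    then obtain x y where xy: "y \<in> ?A" "x \<in> P" "(x, y) \<notin> r" using A by blast
    show "strong_upper_bad P r p q"
    proof (cases "has_largest P r")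
      case True
      then obtain m where m: "m \<in> P" "\<forall>x\<in>P. (x, m) \<in> r" by (auto simp: has_largest_def)
      then have "m \<in> ?A" "m \<noteq> y" using A xy assms by (auto simp: incomparable_def)
      then have "card {m, y} \<le> card ?A" using xy fin by (intro card_mono) auto
      then show ?thesis using \<open>m \<noteq> y\<close> by (auto simp: strong_upper_bad_def)
    next
      case False
      have "card ?A > 0" using xy fin by (auto simp: card_gt_0_iff)
      then have "card ?A \<ge> 2 \<or> card ?A = 1" by linarith
      then show ?thesis using False by (auto simp: strong_upper_bad_def)
    qed
  qed
qed

lemma strong_lower_bad_eq_dual: "strong_lower_bad P r = strong_upper_bad P (r\<inverse>)"
proof -
  have "underS r = aboveS (r\<inverse>)" by (auto simp: underS_def aboveS_def fun_eq_iff)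
  moreover have "has_smallest P r = has_largest P (r\<inverse>)"
    by (auto simp: has_smallest_def has_largest_def)
  ultimately show ?thesis by (simp add: strong_lower_bad_def strong_upper_bad_def fun_eq_iff)
qed

lemma strong_lower_bad_iff:
  assumes "incomparable P r p q"
  shows "strong_lower_bad P r p q \<longleftrightarrow> (\<exists>x y. (x, p) \<in> r \<and> (x, q) \<in> r \<and> y \<in> P \<and> (x, y) \<notin> r)"
  using poset_carrier.strong_upper_bad_iff[OF dual, of p q] assms
  by (auto simp: strong_lower_bad_eq_dual incomparable_def)

lemma not_strong_upper_bad_if_union_full:
  assumes "strong_embedding P r n \<iota>" "incomparable P r p q" "\<iota> p \<union> \<iota> q = {1..n}"
  shows "\<not> strong_upper_bad P r p q"
proof
  assume "strong_upper_bad P r p q"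
  then obtain x y where xy: "(p, y) \<in> r" "(q, y) \<in> r" "x \<in> P" "(x, y) \<notin> r"
    using strong_upper_bad_iff[OF assms(2)] by blast
  then have "\<iota> p \<union> \<iota> q \<subseteq> \<iota> y" "\<iota> x \<subseteq> {1..n}"
    using assms(1) le_carrier unfolding strong_embedding_def by blast+
  then have "\<iota> x \<subseteq> \<iota> y" using assms(3) by blast
  then show False using assms(1) xy le_carrier unfolding strong_embedding_def by blast
qed

lemma not_strong_lower_bad_if_disjoint:
  assumes "strong_embedding P r n \<iota>" "incomparable P r p q" "\<iota> p \<inter> \<iota> q = {}"
  shows "\<not> strong_lower_bad P r p q"
proof
  assume "strong_lower_bad P r p q"
  then obtain x y where xy: "(x, p) \<in> r" "(x, q) \<in> r" "y \<in> P" "(x, y) \<notin> r"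
    using strong_lower_bad_iff[OF assms(2)] by blast
  then have "\<iota> x \<subseteq> \<iota> p \<inter> \<iota> q"
    using assms(1) le_carrier unfolding strong_embedding_def by blast
  then have "\<iota> x \<subseteq> \<iota> y" using assms(3) by blast
  then show False using assms(1) xy le_carrier unfolding strong_embedding_def by blast
qed

text \<open>
  For a good pair, the up-sets that contain exactly one of \<open>p\<close>, \<open>q\<close> already separate. If \<open>(x, y) \<notin> r\<close>
  then \<open>x\<close> is not below both (else it would be smallest) and \<open>y\<close> is not above both (else it would be
  largest). Hence the principal up-set of \<open>x\<close> works, or it contains neither \<open>p\<close> nor \<open>q\<close> and
  the up-set of that one of \<open>p\<close>, \<open>q\<close> which is not below \<open>y\<close> can be added to it.
\<close>

lemma incomparable_adjacent_good:
  assumes good: "incomparable_good P r" and FG: "F \<subseteq> {1..n}" "G \<subseteq> {1..n}"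
    and big: "2 ^ card P \<le> card (F - G)" "2 ^ card P \<le> card (G - F)"
  shows "copy_adjacent P r n F G"
proof -
  obtain p q where pq: "incomparable P r p q" "\<not> strong_bad P r p q"
    using good by (auto simp: incomparable_good_def)
  then have c: "p \<in> P" "q \<in> P" "(p, q) \<notin> r" "(q, p) \<notin> r" by (auto simp: incomparable_def)
  have up: "(x, y) \<in> r" if "(p, y) \<in> r" "(q, y) \<in> r" "x \<in> P" for x y
    using pq that strong_upper_bad_iff[OF pq(1)] by (auto simp: strong_bad_def)
  have down: "(x, y) \<in> r" if "(x, p) \<in> r" "(x, q) \<in> r" "y \<in> P" for x y
    using pq that strong_lower_bad_iff[OF pq(1)] by (auto simp: strong_bad_def)
  let ?U = "{U. upset P r U \<and> (p \<in> U) \<noteq> (q \<in> U)}"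
  have "\<exists>U\<in>?U. x \<in> U \<and> y \<notin> U" if xy: "x \<in> P" "y \<in> P" "(x, y) \<notin> r" for x y
  proof -
    have u: "upset P r {z. (a, z) \<in> r}" "upset P r {z. (a, z) \<in> r \<or> (b, z) \<in> r}" for a b
      using le_carrier le_trans unfolding upset_def by blast+
    consider "((x, p) \<in> r) \<noteq> ((x, q) \<in> r)" | "(x, p) \<notin> r" "(x, q) \<notin> r" "(p, y) \<notin> r"
      | "(x, p) \<notin> r" "(x, q) \<notin> r" "(q, y) \<notin> r"
      using up down xy by blast
    then show ?thesis
    proof cases
      case 1 then show ?thesis using u(1)[of x] xy le_refl
        by (intro bexI[of _ "{z. (x, z) \<in> r}"]) auto
    next
      case 2 then show ?thesis using u(2)[of x p] xy c le_refl
        by (intro bexI[of _ "{z. (x, z) \<in> r \<or> (p, z) \<in> r}"]) auto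
    next
      case 3 then show ?thesis using u(2)[of x q] xy c le_refl
        by (intro bexI[of _ "{z. (x, z) \<in> r \<or> (q, z) \<in> r}"]) auto
    qed
  qed
  then have sep: "separating P r ?U" by (auto simp: separating_def)
  have empty: "{U \<in> ?U. p \<in> U \<and> q \<in> U} = {}" "{U \<in> ?U. p \<notin> U \<and> q \<notin> U} = {}" by auto
  note small = card_separating_le[OF finite_carrier sep]
  have "\<exists>\<iota>. strong_embedding P r n \<iota> \<and> \<iota> p = F \<and> \<iota> q = G"
    using c by (intro exists_embedding_of_separating[OF sep c(1,2) FG]
      order.trans[OF small big(1)] order.trans[OF small big(2)], unfold empty) auto
  then show ?thesis using c by (auto simp: copy_adjacent_def)
qed

section \<open>The parameters lambda\<close>

text \<open>
  Drop from the family \<open>non_below P r ` P\<close> the members that contain neither \<open>p\<close> nor \<open>q\<close>. They belong to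
  common upper bounds \<open>y\<close> of \<open>p\<close> and \<open>q\<close>; the pair is not strong upper bad, so such a \<open>y\<close> is the
  largest element and \<open>non_below P r y\<close> is empty.
\<close>

lemma exists_cover_embedding:
  assumes pq: "incomparable P r p q" "\<not> strong_upper_bad P r p q"
  shows "\<exists>N \<iota>. (N, \<iota>) \<in> strong_embeddings P r \<and> \<iota> p \<union> \<iota> q = {1..N}"
proof -
  define K where "K = (2::nat) ^ card P"
  have c: "p \<in> P" "q \<in> P" "(p, q) \<notin> r" "(q, p) \<notin> r" "p \<noteq> q"
    using pq le_refl by (auto simp: incomparable_def)
  let ?U = "non_below P r ` {y \<in> P. \<not> ((p, y) \<in> r \<and> (q, y) \<in> r)}"
  have sep: "separating P r ?U"
  proof -
    have "\<exists>U\<in>?U. x \<in> U \<and> y \<notin> U" if "x \<in> P" "y \<in> P" "(x, y) \<notin> r" for x y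
    proof -
      have "\<not> ((p, y) \<in> r \<and> (q, y) \<in> r)"
        using pq(2) that strong_upper_bad_iff[OF pq(1)] by blast
      then show ?thesis
        using that le_refl by (intro bexI[of _ "non_below P r y"]) (auto simp: non_below_def)
    qed
    then show ?thesis using upset_non_below by (auto simp: separating_def)
  qed
  have ff: "{U \<in> ?U. p \<notin> U \<and> q \<notin> U} = {}" using c by (auto simp: non_below_def)
  let ?F = "{1..2 * K}" and ?G = "{K + 1..3 * K}"
  have sets: "?F \<inter> ?G = {K + 1..2 * K}" "?F - ?G = {1..K}" "?G - ?F = {2 * K + 1..3 * K}"
      "?F \<union> ?G = {1..3 * K}" by auto
  have small: "card {U \<in> ?U. Q U} \<le> K" for Q
    using card_separating_le[OF finite_carrier sep] by (simp add: K_def)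
  have "\<exists>\<iota>. strong_embedding P r (3 * K) \<iota> \<and> \<iota> p = ?F \<and> \<iota> q = ?G"
    by (rule exists_embedding_of_separating[OF sep], unfold sets ff) (use c small in auto)
  then obtain \<iota> where "strong_embedding P r (3 * K) \<iota>" "\<iota> p \<union> \<iota> q = {1..3 * K}"
    using sets by metis
  then show ?thesis
    using embedding_positive[OF _ c(1,2,5)] unfolding strong_embeddings_def mem_Collect_eq case_prod_conv
    by blast
qed

text \<open>
  Complementation turns embeddings of the reversed order into embeddings of \<open>P\<close>; it yields the
  statements about lower bounds from those about upper bounds.
\<close>

lemma dual_embedding:
  assumes "strong_embedding P (r\<inverse>) N \<iota>"
  shows "strong_embedding P r N (\<lambda>x. {1..N} - \<iota> x)"
proof -
  have "\<iota> x \<subseteq> {1..N}" if "x \<in> P" for x using assms that by (auto simp: strong_embedding_def)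
  then have "{1..N} - \<iota> x \<subseteq> {1..N} - \<iota> y \<longleftrightarrow> \<iota> y \<subseteq> \<iota> x" if "x \<in> P" "y \<in> P" for x y
    using that by blast
  then have order: "(x, y) \<in> r \<longleftrightarrow> {1..N} - \<iota> x \<subseteq> {1..N} - \<iota> y" if "x \<in> P" "y \<in> P" for x y
    using assms that by (auto simp: strong_embedding_def)
  moreover have "inj_on (\<lambda>x. {1..N} - \<iota> x) P"
    using order le_antisym by (intro inj_onI) auto
  ultimately show ?thesis by (auto simp: strong_embedding_def)
qed

lemma exists_disjoint_embedding:
  assumes pq: "incomparable P r p q" "\<not> strong_lower_bad P r p q"
  shows "\<exists>N \<iota>. (N, \<iota>) \<in> strong_embeddings P r \<and> \<iota> p \<inter> \<iota> q = {}"
proof -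
  have "\<not> strong_upper_bad P (r\<inverse>) p q" "incomparable P (r\<inverse>) p q"
    using pq strong_lower_bad_eq_dual by (auto simp: incomparable_def)
  then obtain N \<iota> where h: "(N, \<iota>) \<in> strong_embeddings P (r\<inverse>)" "\<iota> p \<union> \<iota> q = {1..N}"
    using poset_carrier.exists_cover_embedding[OF dual] by blast
  then have "(N, \<lambda>x. {1..N} - \<iota> x) \<in> strong_embeddings P r"
    using dual_embedding by (auto simp: strong_embeddings_def)
  then show ?thesis using h(2) by (intro exI[of _ N] exI[of _ "\<lambda>x. {1..N} - \<iota> x"]) auto
qed

text \<open>
  Transplantation of an arbitrary embedding when both differences have room to spare. With
  \<open>\<iota> p \<union> \<iota> q\<close> equal to the ground set the condition on the outside is void, and with disjoint
  \<open>\<iota> p\<close>, \<open>\<iota> q\<close> the one on the intersection is.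
\<close>

lemma incomparable_adjacent_lambda:
  assumes emb: "strong_embedding P r N \<iota>" and pq: "incomparable P r p q"
    and FG: "F \<subseteq> {1..n}" "G \<subseteq> {1..n}"
    and big: "2 ^ card P \<le> card (F - G)" "2 ^ card P \<le> card (G - F)"
    and inter: "card (\<iota> p \<inter> \<iota> q) \<le> card (F \<inter> G)"
    and outer: "N - card (\<iota> p \<union> \<iota> q) \<le> n - card (F \<union> G)"
  shows "copy_adjacent P r n F G"
proof -
  have c: "p \<in> P" "q \<in> P" "(p, q) \<notin> r" "(q, p) \<notin> r" using pq by (auto simp: incomparable_def)
  have sub: "\<iota> p \<subseteq> {1..N}" "\<iota> q \<subseteq> {1..N}" using emb c by (auto simp: strong_embedding_def)
  let ?U = "coordinate_upsets P N \<iota>"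
  note sep = separating_coordinate_upsets[OF emb]
  note small = card_separating_le[OF finite_carrier sep]
  have "{j \<in> {1..N}. j \<in> \<iota> p \<and> j \<in> \<iota> q} = \<iota> p \<inter> \<iota> q"
       "{j \<in> {1..N}. j \<notin> \<iota> p \<and> j \<notin> \<iota> q} = {1..N} - (\<iota> p \<union> \<iota> q)"
    using sub by auto
  moreover have "card ({1..N} - (\<iota> p \<union> \<iota> q)) = N - card (\<iota> p \<union> \<iota> q)"
    using sub by (subst card_Diff_subset) (auto intro: finite_subset)
  ultimately have types:
      "card {U \<in> ?U. p \<in> U \<and> q \<in> U} \<le> card (F \<inter> G)"
      "card {U \<in> ?U. p \<notin> U \<and> q \<notin> U} \<le> n - card (F \<union> G)"
    using card_coordinate_upsets_le[of N \<iota> "\<lambda>U. p \<in> U \<and> q \<in> U"] inter outer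
      card_coordinate_upsets_le[of N \<iota> "\<lambda>U. p \<notin> U \<and> q \<notin> U"] c by simp_all
  then have "\<exists>\<iota>. strong_embedding P r n \<iota> \<and> \<iota> p = F \<and> \<iota> q = G"
    using c by (intro exists_embedding_of_separating[OF sep c(1,2) FG] types
      order.trans[OF small big(1)] order.trans[OF small big(2)])
  then show ?thesis using c by (auto simp: copy_adjacent_def)
qed

lemma lambda_minus_le:
  assumes "strong_embedding P r N \<iota>" "incomparable P r p q" "\<iota> p \<union> \<iota> q = {1..N}"
  shows "lambda_minus P r \<le> card (\<iota> p \<inter> \<iota> q)"
proof -
  have "p \<in> P" "q \<in> P" "p \<noteq> q" using assms(2) le_refl by (auto simp: incomparable_def)
  then have "(N, \<iota>) \<in> strong_embeddings P r"
    using assms(1) embedding_positive by (auto simp: strong_embeddings_def)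
  then show ?thesis
    unfolding lambda_minus_def using assms by (intro wellorder_Inf_le1) blast
qed

lemma lambda_plus_le:
  assumes "strong_embedding P r N \<iota>" "incomparable P r p q" "\<iota> p \<inter> \<iota> q = {}"
  shows "lambda_plus P r \<le> N - card (\<iota> p \<union> \<iota> q)"
proof -
  have "p \<in> P" "q \<in> P" "p \<noteq> q" using assms(2) le_refl by (auto simp: incomparable_def)
  then have "(N, \<iota>) \<in> strong_embeddings P r"
    using assms(1) embedding_positive by (auto simp: strong_embeddings_def)
  then show ?thesis
    unfolding lambda_plus_def using assms by (intro wellorder_Inf_le1) blast
qed

lemma lambda_minus_attained:
  assumes "\<not> incomparable_upper_bad P r"
  shows "\<exists>N \<iota> p q. strong_embedding P r N \<iota> \<and> incomparable P r p q \<and> \<iota> p \<union> \<iota> q = {1..N} \<and>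
    card (\<iota> p \<inter> \<iota> q) = lambda_minus P r"
proof -
  obtain p q where pq: "incomparable P r p q" "\<not> strong_upper_bad P r p q"
    using assms by (auto simp: incomparable_upper_bad_def)
  then obtain N \<iota> where h: "(N, \<iota>) \<in> strong_embeddings P r" "\<iota> p \<union> \<iota> q = {1..N}"
    using exists_cover_embedding by blast
  then have "lambda_minus P r \<in> {card (\<iota> p \<inter> \<iota> q) | N \<iota> p q.
     (N, \<iota>) \<in> strong_embeddings P r \<and> incomparable P r p q \<and> \<iota> p \<union> \<iota> q = {1..N}}"
    unfolding lambda_minus_def using pq by (intro wellorder_InfI[of "card (\<iota> p \<inter> \<iota> q)"]) blast
  then show ?thesis unfolding strong_embeddings_def mem_Collect_eq case_prod_conv by metis
qed

lemma lambda_plus_attained: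
  assumes "\<not> incomparable_lower_bad P r"
  shows "\<exists>N \<iota> p q. strong_embedding P r N \<iota> \<and> incomparable P r p q \<and> \<iota> p \<inter> \<iota> q = {} \<and>
    N - card (\<iota> p \<union> \<iota> q) = lambda_plus P r"
proof -
  obtain p q where pq: "incomparable P r p q" "\<not> strong_lower_bad P r p q"
    using assms by (auto simp: incomparable_lower_bad_def)
  then obtain N \<iota> where h: "(N, \<iota>) \<in> strong_embeddings P r" "\<iota> p \<inter> \<iota> q = {}"
    using exists_disjoint_embedding by blast
  then have "lambda_plus P r \<in> {N - card (\<iota> p \<union> \<iota> q) | N \<iota> p q.
     (N, \<iota>) \<in> strong_embeddings P r \<and> incomparable P r p q \<and> \<iota> p \<inter> \<iota> q = {}}"
    unfolding lambda_plus_def using pq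
    by (intro wellorder_InfI[of "N - card (\<iota> p \<union> \<iota> q)"]) blast
  then show ?thesis unfolding strong_embeddings_def mem_Collect_eq case_prod_conv by metis
qed

text \<open>
  Covering the ground set excludes strong upper badness and disjointness excludes strong lower
  badness. So complementary sets are never adjacent unless \<open>P\<close> is good, and both \<open>lambda\<close> parameters
  of a mixed bad poset are positive.
\<close>

lemma exact_complements_not_embedded:
  assumes bad: "\<not> incomparable_good P r"
    and "strong_embedding P r n \<iota>" "incomparable P r p q" "\<iota> p \<union> \<iota> q = {1..n}" "\<iota> p \<inter> \<iota> q = {}"
  shows False
  using not_strong_upper_bad_if_union_full[OF assms(2-4)]
    not_strong_lower_bad_if_disjoint[OF assms(2,3,5)] assms
  by (auto simp: incomparable_good_def strong_bad_def)

text \<open>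
  Let \<open>p\<close>, \<open>q\<close> be a topmost incomparable pair. Its upper bounds form a chain, which is nonempty because
  the pair is strong upper bad; let \<open>z\<close> be the least of them. The elements above \<open>p\<close> are then \<open>p\<close>
  itself and elements above \<open>z\<close>, so \<open>non_below P r p\<close> is the only member of the family that contains
  \<open>z\<close> and not \<open>p\<close>.
\<close>

lemma sigma_le_one_upper_bad:
  assumes nt: "\<not> total_on P r" and bad: "incomparable_upper_bad P r"
  shows "sigma P r \<le> 1"
proof -
  obtain p q where pq: "incomparable P r p q" "aboveS r p = aboveS r q"
    and chain: "\<forall>x\<in>aboveS r p. \<forall>y\<in>aboveS r p. (x, y) \<in> r \<or> (y, x) \<in> r"
    using top_incomparable_pair[OF nt] by metis
  have "strong_upper_bad P r p q" using bad pq by (auto simp: incomparable_upper_bad_def)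
  then have ne: "aboveS r p \<noteq> {}" using pq(2) by (auto simp: strong_upper_bad_def)
  obtain z where z: "z \<in> aboveS r p"
    and most: "\<And>y. y \<in> aboveS r p \<Longrightarrow> card (aboveS r y) \<le> card (aboveS r z)"
  proof -
    have fin: "finite (aboveS r p)" using aboveS_subset finite_carrier finite_subset by blast
    have "Max ((\<lambda>y. card (aboveS r y)) ` aboveS r p) \<in> (\<lambda>y. card (aboveS r y)) ` aboveS r p"
      using fin ne by (intro Max_in) auto
    then obtain z where "z \<in> aboveS r p"
        "card (aboveS r z) = Max ((\<lambda>y. card (aboveS r y)) ` aboveS r p)" by auto
    then show thesis using that fin by simp
  qed
  have min: "(z, y) \<in> r" if "y \<in> aboveS r p" for y
  proof (rule ccontr)
    assume n: "(z, y) \<notin> r"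
    then have "(y, z) \<in> r" using chain z that by blast
    moreover have "y \<noteq> z" using n le_refl z aboveS_subset by blast
    ultimately have "z \<in> aboveS r y" by (auto simp: aboveS_def)
    then show False using card_aboveS_less most[OF that] by fastforce
  qed
  have c: "(p, z) \<in> r" "p \<noteq> z" "p \<in> P" "z \<in> P" "(z, p) \<notin> r"
    using z le_carrier le_antisym by (auto simp: aboveS_def)
  let ?U = "non_below P r ` P"
  define K where "K = (2::nat) ^ card P"
  have small: "card {U \<in> ?U. Q U} \<le> K" for Q
    using card_separating_le[OF finite_carrier separating_non_below] by (simp add: K_def)
  have tf: "{U \<in> ?U. p \<in> U \<and> z \<notin> U} = {}"
    using upset_non_below c by (auto simp: upset_def)
  have "y = p" if "y \<in> P" "p \<notin> non_below P r y" "z \<in> non_below P r y" for y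
  proof (rule ccontr)
    assume "y \<noteq> p"
    then have "y \<in> aboveS r p" using that c by (auto simp: non_below_def aboveS_def)
    then show False using min that by (auto simp: non_below_def)
  qed
  then have sub: "{U \<in> ?U. p \<notin> U \<and> z \<in> U} \<subseteq> {non_below P r p}" by blast
  have ft: "card {U \<in> ?U. p \<notin> U \<and> z \<in> U} \<le> 1"
    using card_mono[OF _ sub] by simp
  let ?F = "{1..K}" and ?G = "{1..K + 1}"
  have sets: "?F \<inter> ?G = ?F" "?F - ?G = {}" "?G - ?F = {K + 1}" "?F \<union> ?G = ?G" by auto
  have "\<exists>\<iota>. strong_embedding P r (2 * K + 1) \<iota> \<and> \<iota> p = ?F \<and> \<iota> z = ?G"
    by (rule exists_embedding_of_separating[OF separating_non_below], unfold sets tf)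
       (use c small ft in auto)
  then obtain \<iota> where i: "strong_embedding P r (2 * K + 1) \<iota>" "\<iota> z - \<iota> p = {K + 1}"
    using sets by metis
  then show ?thesis using sigma_le[OF i(1) c(1,2)] by simp
qed

lemma sigma_eq_one:
  assumes nt: "\<not> total_on P r" and na: "\<not> is_antichain P r"
    and bad: "incomparable_upper_bad P r \<or> incomparable_lower_bad P r"
  shows "sigma P r = 1"
proof -
  have "sigma P r \<le> 1"
  proof (cases "incomparable_upper_bad P r")
    case True then show ?thesis using sigma_le_one_upper_bad nt by blast
  next
    case False
    then have "incomparable_upper_bad P (r\<inverse>)" "\<not> total_on P (r\<inverse>)"
      using bad nt strong_lower_bad_eq_dual
      by (auto simp: incomparable_upper_bad_def incomparable_lower_bad_def incomparable_def)
    then have le: "sigma P (r\<inverse>) \<le> 1"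
      using poset_carrier.sigma_le_one_upper_bad[OF dual] by blast
    have "\<not> is_antichain P (r\<inverse>)" using na by (auto simp: is_antichain_def)
    then obtain N \<iota> p q where h: "strong_embedding P (r\<inverse>) N \<iota>" "(p, q) \<in> r\<inverse>" "p \<noteq> q"
        "card (\<iota> q - \<iota> p) = sigma P (r\<inverse>)"
      using poset_carrier.sigma_attained[OF dual] by blast
    have "\<iota> q \<subseteq> {1..N}"
      using h le_carrier unfolding strong_embedding_def by blast
    then have "({1..N} - \<iota> p) - ({1..N} - \<iota> q) = \<iota> q - \<iota> p" by blast
    then show ?thesis using sigma_le[OF dual_embedding[OF h(1)], of q p] h le by auto
  qed
  then show ?thesis using sigma_pos[OF na] by simp
qed

end

section \<open>Comparability in an independent set\<close>

lemma copy_adjacent_commute: "copy_adjacent P r n F G \<longleftrightarrow> copy_adjacent P r n G F"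
  by (auto simp: copy_adjacent_def)

text \<open>
  The members of a chain have distinct sizes, which lie between those of the least and the greatest
  member.
\<close>

lemma card_chain_le:
  assumes "chain_subset C" "C \<noteq> {}" "finite C" "\<And>X. X \<in> C \<Longrightarrow> finite X"
  obtains A B where "A \<in> C" "B \<in> C" "A \<subseteq> B" "card C \<le> card B - card A + 1"
proof -
  have ch: "subset.chain UNIV C" using assms(1) by (simp add: chain_subset_alt_def)
  have A: "\<Inter>C \<in> C" and B: "\<Union>C \<in> C"
    using Inter_in_chain[OF assms(3,2) ch] Union_in_chain[OF assms(3,2) ch] .
  have "inj_on card C"
    using assms(1,4) unfolding chain_subset_def by (intro inj_onI) (metis card_subset_eq)
  then have "card C = card (card ` C)" by (simp add: card_image)
  also have "\<dots> \<le> card {card (\<Inter>C)..card (\<Union>C)}"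
    using assms(4) A B by (intro card_mono) (auto intro!: card_mono)
  also have "\<dots> \<le> card (\<Union>C) - card (\<Inter>C) + 1" by simp
  finally show thesis using that A B by blast
qed

lemma two_comparability_classes:
  fixes S :: "'b set set"
  assumes trans: "\<And>A B C. A \<in> S \<Longrightarrow> B \<in> S \<Longrightarrow> C \<in> S \<Longrightarrow> A \<subseteq> B \<or> B \<subseteq> A \<Longrightarrow>
      B \<subseteq> C \<or> C \<subseteq> B \<Longrightarrow> A \<subseteq> C \<or> C \<subseteq> A"
    and three: "\<And>A B C. A \<in> S \<Longrightarrow> B \<in> S \<Longrightarrow> C \<in> S \<Longrightarrow>
      (A \<subseteq> B \<or> B \<subseteq> A) \<or> (B \<subseteq> C \<or> C \<subseteq> B) \<or> (A \<subseteq> C \<or> C \<subseteq> A)"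
    and nc: "\<not> chain_subset S"
  obtains C D where "chain_subset C" "chain_subset D" "S = C \<union> D" "C \<noteq> {}" "D \<noteq> {}"
    "\<And>A B. A \<in> C \<Longrightarrow> B \<in> D \<Longrightarrow> \<not> A \<subseteq> B \<and> \<not> B \<subseteq> A"
proof -
  define cmp where "cmp A B \<longleftrightarrow> A \<subseteq> B \<or> B \<subseteq> A" for A B :: "'b set"
  have t: "cmp A C" if "cmp A B" "cmp B C" "A \<in> S" "B \<in> S" "C \<in> S" for A B C
    using trans[OF that(3-5)] that by (simp add: cmp_def)
  have h: "cmp A B \<or> cmp B C \<or> cmp A C" if "A \<in> S" "B \<in> S" "C \<in> S" for A B C
    using three[OF that] by (simp add: cmp_def)
  have sym: "cmp A B \<longleftrightarrow> cmp B A" for A B by (auto simp: cmp_def)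
  have rf: "cmp A A" for A by (simp add: cmp_def)
  obtain F G where FG: "F \<in> S" "G \<in> S" "\<not> cmp F G"
    using nc by (auto simp: chain_subset_def cmp_def)
  let ?C = "{H \<in> S. cmp H F}" and ?D = "{H \<in> S. cmp H G}"
  have "S = ?C \<union> ?D" using h[of _ F G] FG sym by blast
  moreover have "chain_subset ?C" "chain_subset ?D"
    using t sym FG unfolding chain_subset_def cmp_def[symmetric] by blast+
  moreover have "?C \<noteq> {}" "?D \<noteq> {}" using FG rf by blast+
  moreover have "\<not> A \<subseteq> B \<and> \<not> B \<subseteq> A" if "A \<in> ?C" "B \<in> ?D" for A B
  proof -
    have "\<not> cmp A B" using that t sym FG by blast
    then show ?thesis by (simp add: cmp_def)
  qed
  ultimately show thesis using that by blast
qed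

lemma independence_number_eqI:
  assumes "independent_set (middle_copy_graph P r n) S" "card S = v"
    and "\<And>S. independent_set (middle_copy_graph P r n) S \<Longrightarrow> card S \<le> v"
  shows "independence_number (middle_copy_graph P r n) = v"
  unfolding independence_number_def
proof (rule Max_eqI)
  have "{card S |S. independent_set (middle_copy_graph P r n) S} \<subseteq> card ` Pow (Pow {1..n})"
    by (auto simp: independent_middle_iff middle_layers_def)
  then show "finite {card S |S. independent_set (middle_copy_graph P r n) S}"
    by (rule finite_subset) simp
qed (use assms in auto)

text \<open>
  Requirements on \<open>n\<close> that hold for all large \<open>n\<close>. The window \<open>n powr (2 / 3)\<close> is at most \<open>n / 16\<close>, so all
  sizes in the middle layers lie between \<open>7 n / 16\<close> and \<open>9 n / 16\<close>: this is narrow enough that three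
  sets cannot be pairwise nearly complementary. The factor 48 absorbs the constants in
  those estimates, and the last requirement makes room for the segments used in the lower bounds.
\<close>

locale large_ground = poset_carrier P r for P :: "'a set" and r +
  fixes n :: nat
  assumes not_chain: "\<not> total_on P r" and not_antichain: "\<not> is_antichain P r"
    and window_le: "real n powr (2 / 3) \<le> real n / 16"
    and size_bound: "48 * (2 ^ card P + sigma P r + lambda_plus P r + 1) \<le> n"
    and window_ge: "real (sigma P r + lambda_plus P r + 2) \<le> real n powr (2 / 3)"
begin

lemma large:
  "48 * 2 ^ card P \<le> n" "1 \<le> (2::nat) ^ card P" "48 * sigma P r + 48 * lambda_plus P r + 48 \<le> n"
  "48 * 2 ^ card P + 48 \<le> n"
  using size_bound by simp_all

lemma middle_card:
  assumes "F \<in> middle_layers n"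
  shows "F \<subseteq> {1..n}" "finite F" "7 * n \<le> 16 * card F" "16 * card F \<le> 9 * n"
proof -
  show "F \<subseteq> {1..n}" using assms by (simp add: middle_layers_def)
  then show "finite F" by (rule finite_subset) simp
  have "\<bar>real (card F) - real n / 2\<bar> \<le> real n / 16"
    using assms window_le by (auto simp: middle_layers_def)
  then have "real n / 2 - real (card F) \<le> real n / 16" "real (card F) - real n / 2 \<le> real n / 16"
    by linarith+
  then show "7 * n \<le> 16 * card F" "16 * card F \<le> 9 * n" by linarith+
qed

lemma nonadjacent_comparable:
  assumes F: "F \<in> middle_layers n" and G: "G \<in> middle_layers n" and "F \<subseteq> G"
    and na: "F \<noteq> G \<Longrightarrow> \<not> copy_adjacent P r n F G"
  shows "card (G - F) < sigma P r"
proof (cases "F = G")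
  case True then show ?thesis using sigma_pos[OF not_antichain] by simp
next
  case False
  have "2 ^ card P \<le> card F" "2 ^ card P \<le> n - card G"
    using middle_card[OF F] middle_card[OF G] large by linarith+
  then show ?thesis
    using comparable_adjacent[OF not_antichain assms(3) middle_card(1)[OF G]] na False
    by (meson not_le)
qed

text \<open>
  One of the intersection and the outside is smaller than \<open>2 ^ card P\<close>. Their sizes differ by
  \<open>card F + card G - n\<close>, which is at most \<open>n / 8\<close> in absolute value, so the other one is small too.
\<close>

lemma nonadjacent_incomparable:
  assumes F: "F \<in> middle_layers n" and G: "G \<in> middle_layers n" and FG: "\<not> F \<subseteq> G" "\<not> G \<subseteq> F"
    and na: "\<not> copy_adjacent P r n F G"
  shows "8 * card (F \<inter> G) \<le> n + 8 * 2 ^ card P" "8 * (n - card (F \<union> G)) \<le> n + 8 * 2 ^ card P"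
proof -
  have sum: "card F + card G = card (F \<union> G) + card (F \<inter> G)"
    using middle_card(2)[OF F] middle_card(2)[OF G] by (rule card_Un_Int)
  have "card (F \<union> G) \<le> card {1..n}"
    using middle_card(1)[OF F] middle_card(1)[OF G] by (intro card_mono) auto
  then have le: "card (F \<union> G) \<le> n" by simp
  have "card (F \<inter> G) < 2 ^ card P \<or> n - card (F \<union> G) < 2 ^ card P"
    using incomparable_adjacent_middle[OF not_chain middle_card(1)[OF F] middle_card(1)[OF G] FG] na
    by (meson not_le)
  then show "8 * card (F \<inter> G) \<le> n + 8 * 2 ^ card P" "8 * (n - card (F \<union> G)) \<le> n + 8 * 2 ^ card P"
    using sum le middle_card(3,4)[OF F] middle_card(3,4)[OF G] by linarith+
qed

lemma nonadjacent_incomparable_diff: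
  assumes F: "F \<in> middle_layers n" and G: "G \<in> middle_layers n" and FG: "\<not> F \<subseteq> G" "\<not> G \<subseteq> F"
    and na: "\<not> copy_adjacent P r n F G"
  shows "n < 4 * card (F - G)" "n < 4 * card (G - F)"
proof -
  have "card F = card (F - G) + card (F \<inter> G)" "card G = card (G - F) + card (F \<inter> G)"
    using middle_card(2)[OF F] middle_card(2)[OF G] card_Diff_subset_Int[of F G]
      card_Diff_subset_Int[of G F] card_mono[of F "F \<inter> G"] card_mono[of G "F \<inter> G"]
    by (auto simp: Int_commute)
  then show "n < 4 * card (F - G)" "n < 4 * card (G - F)"
    using nonadjacent_incomparable(1)[OF assms] middle_card(3)[OF F] middle_card(3)[OF G] large
    by linarith+
qed

context
  fixes S
  assumes indep: "independent_set (middle_copy_graph P r n) S"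
begin

lemma in_middle: "F \<in> S \<Longrightarrow> F \<in> middle_layers n"
  and nonadjacent: "F \<in> S \<Longrightarrow> G \<in> S \<Longrightarrow> F \<noteq> G \<Longrightarrow> \<not> copy_adjacent P r n F G"
  using indep by (auto simp: independent_middle_iff)

lemma finite_independent: "finite S"
proof (rule finite_subset)
  show "S \<subseteq> Pow {1..n}" using in_middle middle_card(1) by blast
qed simp

lemma comparable_close:
  assumes "A \<in> S" "B \<in> S" "A \<subseteq> B \<or> B \<subseteq> A"
  shows "card (A - B) < sigma P r"
proof (cases "A \<subseteq> B")
  case True
  then have "A - B = {}" by blast
  then show ?thesis using sigma_pos[OF not_antichain] by (metis One_nat_def Suc_le_lessD card.empty)
next
  case False
  then show ?thesis
    using assms nonadjacent_comparable[of B A] in_middle nonadjacent by blast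
qed

text \<open>
  Two steps between comparable sets remove fewer than \<open>2 * sigma P r\<close> elements, while
  incomparable sets in \<open>S\<close> differ in more than \<open>n / 4\<close> elements.
\<close>

lemma comparable_trans:
  assumes S: "A \<in> S" "B \<in> S" "C \<in> S" and "A \<subseteq> B \<or> B \<subseteq> A" "B \<subseteq> C \<or> C \<subseteq> B"
  shows "A \<subseteq> C \<or> C \<subseteq> A"
proof (rule ccontr)
  assume n: "\<not> ?thesis"
  have fin: "finite A" "finite B" using S in_middle middle_card by blast+
  have "card (A - C) \<le> card ((A - B) \<union> (B - C))"
    using fin by (intro card_mono) auto
  also have "\<dots> \<le> card (A - B) + card (B - C)" by (rule card_Un_le)
  also have "\<dots> < 2 * sigma P r"
    using comparable_close[of A B] comparable_close[of B C] assms by linarith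
  finally have "4 * card (A - C) \<le> n" using large by linarith
  moreover have "n < 4 * card (A - C)"
    using nonadjacent_incomparable_diff(1)[of A C] n S in_middle nonadjacent by blast
  ultimately show False by simp
qed

text \<open>
  The set \<open>C\<close> is covered by \<open>A \<inter> C\<close>, \<open>B \<inter> C\<close> and the outside of \<open>A \<union> B\<close>. Each has at most about
  \<open>n / 8\<close> elements, too few for a set of at least \<open>7 n / 16\<close> elements.
\<close>

lemma no_three_incomparable:
  assumes S: "A \<in> S" "B \<in> S" "C \<in> S"
  shows "(A \<subseteq> B \<or> B \<subseteq> A) \<or> (B \<subseteq> C \<or> C \<subseteq> B) \<or> (A \<subseteq> C \<or> C \<subseteq> A)"
proof (rule ccontr)
  assume n: "\<not> ?thesis"
  note m = in_middle[OF S(1)] in_middle[OF S(2)] in_middle[OF S(3)]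
  have na: "\<not> copy_adjacent P r n A B" "\<not> copy_adjacent P r n B C" "\<not> copy_adjacent P r n A C"
    using n nonadjacent S by blast+
  note b = nonadjacent_incomparable[OF m(1,2) _ _ na(1)] nonadjacent_incomparable[OF m(2,3) _ _ na(2)]
    nonadjacent_incomparable[OF m(1,3) _ _ na(3)]
  have "C \<subseteq> (A \<inter> C) \<union> ((B \<inter> C) \<union> ({1..n} - (A \<union> B)))"
    using middle_card(1)[OF m(3)] by blast
  then have "card C \<le> card ((A \<inter> C) \<union> ((B \<inter> C) \<union> ({1..n} - (A \<union> B))))"
    using middle_card(2)[OF m(3)] by (intro card_mono) auto
  also have "\<dots> \<le> card (A \<inter> C) + (card (B \<inter> C) + card ({1..n} - (A \<union> B)))"
    by (rule order.trans[OF card_Un_le] add_left_mono card_Un_le)+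
  also have "card ({1..n} - (A \<union> B)) = n - card (A \<union> B)"
    using middle_card(1,2)[OF m(1)] middle_card(1,2)[OF m(2)] by (subst card_Diff_subset) auto
  finally have "card C \<le> card (A \<inter> C) + (card (B \<inter> C) + (n - card (A \<union> B)))" .
  moreover have "8 * card (A \<inter> C) \<le> n + 8 * 2 ^ card P" "8 * card (B \<inter> C) \<le> n + 8 * 2 ^ card P"
      "8 * (n - card (A \<union> B)) \<le> n + 8 * 2 ^ card P"
    using b n by blast+
  ultimately show False
    using middle_card(3)[OF m(3)] large by linarith
qed

lemma card_chain_in_independent:
  assumes "chain_subset C" "C \<subseteq> S"
  shows "card C \<le> sigma P r"
proof (cases "C = {}")
  case False
  have fin: "finite C" "\<And>X. X \<in> C \<Longrightarrow> finite X"
    using assms finite_independent finite_subset in_middle middle_card(2) by blast+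
  obtain A B where AB: "A \<in> C" "B \<in> C" "A \<subseteq> B" "card C \<le> card B - card A + 1"
    using card_chain_le[OF assms(1) False fin] by metis
  have "card (B - A) = card B - card A"
    using AB fin by (intro card_Diff_subset) auto
  then show ?thesis using comparable_close[of B A] AB assms(2) by fastforce
qed simp

lemma independent_structure:
  obtains (chain) "chain_subset S"
  | (two_chains) C D where "chain_subset C" "chain_subset D" "S = C \<union> D" "C \<noteq> {}" "D \<noteq> {}"
      "\<And>A B. A \<in> C \<Longrightarrow> B \<in> D \<Longrightarrow> \<not> A \<subseteq> B \<and> \<not> B \<subseteq> A"
proof (cases "chain_subset S")
  case True then show thesis using chain by blast
next
  case False
  show thesis
    by (rule two_comparability_classes[OF comparable_trans no_three_incomparable False])
      (assumption+, rule two_chains, assumption+)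
qed

lemma card_independent_le_two_sigma: "card S \<le> 2 * sigma P r"
proof (cases rule: independent_structure)
  case chain then show ?thesis using card_chain_in_independent[of S] by simp
next
  case (two_chains C D)
  then have "card S \<le> card C + card D" by (simp add: card_Un_le)
  then show ?thesis
    using card_chain_in_independent[of C] card_chain_in_independent[of D] two_chains by auto
qed

lemma card_independent_good:
  assumes "incomparable_good P r"
  shows "card S \<le> sigma P r"
proof (rule card_chain_in_independent)
  have "F \<subseteq> G \<or> G \<subseteq> F" if FG: "F \<in> S" "G \<in> S" for F G
  proof (rule ccontr)
    assume n: "\<not> ?thesis"
    then have na: "\<not> copy_adjacent P r n F G" using nonadjacent FG by blast
    have "n < 4 * card (F - G)" "n < 4 * card (G - F)"
      using nonadjacent_incomparable_diff[OF in_middle[OF FG(1)] in_middle[OF FG(2)] _ _ na] n by auto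
    then have "2 ^ card P \<le> card (F - G)" "2 ^ card P \<le> card (G - F)"
      using large by linarith+
    then show False
      using incomparable_adjacent_good[OF assms middle_card(1)[OF in_middle[OF FG(1)]]
        middle_card(1)[OF in_middle[OF FG(2)]]] na by blast
  qed
  then show "chain_subset S" by (auto simp: chain_subset_def)
qed simp

text \<open>
  Otherwise an embedding that attains \<open>lambda_minus\<close> (respectively \<open>lambda_plus\<close>) could be transplanted
  onto \<open>F\<close> and \<open>G\<close>. It exists since some incomparable pair is not strong upper (lower) bad.
\<close>

lemma nonadjacent_lambda_bounds:
  assumes mixed: "incomparable_mixed_bad P r"
    and FG: "F \<in> S" "G \<in> S" "\<not> F \<subseteq> G" "\<not> G \<subseteq> F"
  shows "card (F \<inter> G) < lambda_minus P r" "n - card (F \<union> G) < lambda_plus P r"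
proof -
  have na: "\<not> copy_adjacent P r n F G" using nonadjacent FG by blast
  have "n < 4 * card (F - G)" "n < 4 * card (G - F)"
    using nonadjacent_incomparable_diff[OF in_middle[OF FG(1)] in_middle[OF FG(2)] FG(3,4) na] .
  then have big: "2 ^ card P \<le> card (F - G)" "2 ^ card P \<le> card (G - F)"
    using large by linarith+
  have sub: "F \<subseteq> {1..n}" "G \<subseteq> {1..n}" using in_middle FG middle_card(1) by blast+
  have bad: "\<not> incomparable_upper_bad P r" "\<not> incomparable_lower_bad P r"
    using mixed by (auto simp: incomparable_mixed_bad_def)
  show "card (F \<inter> G) < lambda_minus P r"
  proof (rule ccontr)
    assume c: "\<not> ?thesis"
    obtain N \<iota> p q where h: "strong_embedding P r N \<iota>" "incomparable P r p q"
        "\<iota> p \<union> \<iota> q = {1..N}" "card (\<iota> p \<inter> \<iota> q) = lambda_minus P r"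
      using lambda_minus_attained[OF bad(1)] by blast
    show False
      using incomparable_adjacent_lambda[OF h(1,2) sub big] h(3,4) c na by simp
  qed
  show "n - card (F \<union> G) < lambda_plus P r"
  proof (rule ccontr)
    assume c: "\<not> ?thesis"
    obtain N \<iota> p q where h: "strong_embedding P r N \<iota>" "incomparable P r p q"
        "\<iota> p \<inter> \<iota> q = {}" "N - card (\<iota> p \<union> \<iota> q) = lambda_plus P r"
      using lambda_plus_attained[OF bad(2)] by blast
    show False
      using incomparable_adjacent_lambda[OF h(1,2) sub big] h(3,4) c na by simp
  qed
qed

text \<open>
  Suppose that there are two chains, from \<open>A1\<close> to \<open>A2\<close> and from \<open>B1\<close> to \<open>B2\<close>. Of the bounds on
  intersections, that for the two greatest members is the strongest, and of the bounds on outsides,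
  that for the two least. They give \<open>card A2 + card B2 < n + lambda_minus P r\<close> and
  \<open>n < card A1 + card B1 + lambda_plus P r\<close>, so the chains together grow by at most
  \<open>lambda_minus P r + lambda_plus P r - 2\<close>; each has one member more than it has steps.
\<close>

lemma card_independent_mixed:
  assumes mixed: "incomparable_mixed_bad P r"
  shows "card S \<le> max (sigma P r) (min (lambda_minus P r + lambda_plus P r) (2 * sigma P r))"
proof (cases rule: independent_structure)
  case chain then show ?thesis using card_chain_in_independent[of S] by simp
next
  case (two_chains C D)
  have fin: "finite C" "finite D" "\<And>X. X \<in> C \<union> D \<Longrightarrow> finite X"
    using two_chains finite_independent in_middle middle_card(2) by auto
  obtain A1 A2 where A: "A1 \<in> C" "A2 \<in> C" "A1 \<subseteq> A2" "card C \<le> card A2 - card A1 + 1"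
    using card_chain_le[of C] two_chains fin by (metis UnCI)
  obtain B1 B2 where B: "B1 \<in> D" "B2 \<in> D" "B1 \<subseteq> B2" "card D \<le> card B2 - card B1 + 1"
    using card_chain_le[of D] two_chains fin by (metis UnCI)
  have 1: "n - card (A1 \<union> B1) < lambda_plus P r"
    using nonadjacent_lambda_bounds[OF mixed, of A1 B1] two_chains A B by blast
  have 2: "card (A2 \<inter> B2) < lambda_minus P r"
    using nonadjacent_lambda_bounds[OF mixed, of A2 B2] two_chains A B by blast
  have "card (A2 \<union> B2) \<le> card {1..n}"
    using A B two_chains in_middle middle_card(1) by (intro card_mono) blast+
  then have 3: "card A2 + card B2 < n + lambda_minus P r"
    using card_Un_Int[of A2 B2] 2 A B fin by simp
  have 4: "n < card A1 + card B1 + lambda_plus P r"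
    using card_Un_le[of A1 B1] 1 by linarith
  have "card A1 \<le> card A2" "card B1 \<le> card B2"
    using A B fin by (auto intro: card_mono)
  then have "card C + card D \<le> lambda_minus P r + lambda_plus P r"
    using A(4) B(4) 3 4 by linarith
  then have "card S \<le> lambda_minus P r + lambda_plus P r"
    using card_Un_le[of C D] two_chains by simp
  then show ?thesis using card_independent_le_two_sigma by simp
qed

end

section \<open>Large independent sets made of intervals\<close>

text \<open>
  Two chains of consecutive segments, growing from the two ends of \<open>{1..n}\<close>. Within one chain the
  differences stay below \<open>sigma P r\<close>, so only the pairs across the chains need a hypothesis. The
  parameter \<open>e\<close> is the size of the gap between the two smallest segments; the case \<open>l = 0\<close> is a
  single chain.
\<close>

lemma interval_family:
  fixes k l e :: nat
  defines "A \<equiv> \<lambda>i. {1..n div 2 + i}" and "B \<equiv> \<lambda>j. {n div 2 + e - j + 1..n}"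
  assumes kl: "k \<le> sigma P r" "l \<le> sigma P r" and e: "e \<le> lambda_plus P r + 1"
    and cross: "\<And>i j. i < k \<Longrightarrow> j < l \<Longrightarrow> \<not> copy_adjacent P r n (A i) (B j)"
  shows "\<exists>S. independent_set (middle_copy_graph P r n) S \<and> card S = k + l"
proof -
  let ?S = "A ` {..<k} \<union> B ` {..<l}"
  have cA: "card (A i) = n div 2 + i" for i by (simp add: A_def)
  have cB: "card (B j) = n - (n div 2 + e - j)" for j by (simp add: B_def)
  have half: "\<bar>real (n div 2) - real n / 2\<bar> \<le> 1" by linarith
  have small: "i \<le> n div 2" "n div 2 + i \<le> n" "n div 2 + e \<le> n" if "i < sigma P r" for i
    using that large e by linarith+
  have mA: "A i \<in> middle_layers n" if "i < k" for i
  proof -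
    have "\<bar>real (n div 2 + i) - real n / 2\<bar> \<le> real n powr (2 / 3)"
      using half window_ge that kl by simp
    moreover have "A i \<subseteq> {1..n}" using small that kl by (auto simp: A_def)
    ultimately show ?thesis using cA by (simp add: middle_layers_def)
  qed
  have mB: "B j \<in> middle_layers n" if "j < l" for j
  proof -
    have j: "j < sigma P r" using that kl by simp
    have "real (n - (n div 2 + e - j)) = real n - real (n div 2) - real e + real j"
      using small[OF j] by (simp add: of_nat_diff)
    then have "\<bar>real (n - (n div 2 + e - j)) - real n / 2\<bar> \<le> real n powr (2 / 3)"
      using half window_ge j e by (simp add: abs_le_iff)
    moreover have "B j \<subseteq> {1..n}" by (auto simp: B_def)
    ultimately show ?thesis using cB by (simp add: middle_layers_def)
  qed
  have AA: "\<not> copy_adjacent P r n (A i) (A i')" if "i < i'" "i' < k" for i i'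
  proof
    assume adj: "copy_adjacent P r n (A i) (A i')"
    have sub: "A i \<subset> A i'" using that by (auto simp: A_def)
    have "card (A i' - A i) = i' - i"
      using sub by (subst card_Diff_subset) (auto simp: cA A_def)
    then show False using sigma_le_of_comparable_adjacent[OF sub adj] that kl by simp
  qed
  have BB: "\<not> copy_adjacent P r n (B j) (B j')" if "j < j'" "j' < l" for j j'
  proof
    assume adj: "copy_adjacent P r n (B j) (B j')"
    have b: "j' \<le> n div 2" "n div 2 + e \<le> n" using small[of j'] that kl by auto
    have "B j \<subseteq> B j'" using that by (auto simp: B_def)
    moreover have less: "card (B j) < card (B j')" using that b by (simp add: cB)
    ultimately have sub: "B j \<subset> B j'" by auto
    have "card (B j' - B j) = card (B j') - card (B j)"
      using sub by (subst card_Diff_subset) (auto simp: B_def)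
    also have "\<dots> = j' - j" using that b by (simp add: cB)
    finally show False using sigma_le_of_comparable_adjacent[OF sub adj] that kl by simp
  qed
  have ind: "independent_set (middle_copy_graph P r n) ?S"
    unfolding independent_middle_iff
  proof (intro conjI ballI impI)
    show "?S \<subseteq> middle_layers n" using mA mB by auto
    fix F G assume F: "F \<in> ?S" and G: "G \<in> ?S" and ne: "F \<noteq> G"
    have AA': "\<not> copy_adjacent P r n (A i) (A i')" if "i < k" "i' < k" "A i \<noteq> A i'" for i i'
      using that AA copy_adjacent_commute by (metis nat_neq_iff)
    have BB': "\<not> copy_adjacent P r n (B i) (B i')" if "i < l" "i' < l" "B i \<noteq> B i'" for i i'
      using that BB copy_adjacent_commute by (metis nat_neq_iff)
    show "\<not> copy_adjacent P r n F G"
      using F G ne AA' BB' cross copy_adjacent_commute[of P r n F G]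
      by (elim UnE imageE) (metis lessThan_iff)+
  qed
  have "A i \<noteq> B j" if "i < k" "j < l" for i j
  proof -
    have b: "i < n div 2" "j \<le> n div 2" "n div 2 + e \<le> n" "n div 2 + i < n" "n div 2 + e - j < n"
      using that kl large e by linarith+
    have "n \<in> B j" using b by (auto simp: B_def)
    moreover have "n \<notin> A i" using b by (simp add: A_def)
    ultimately show ?thesis by blast
  qed
  then have disj: "A ` {..<k} \<inter> B ` {..<l} = {}" by auto
  have "inj_on A {..<k}"
    by (rule inj_onI) (metis add_left_cancel cA)
  moreover have "inj_on B {..<l}"
  proof (rule inj_onI)
    fix i j assume ij: "i \<in> {..<l}" "j \<in> {..<l}" "B i = B j"
    then have "n - (n div 2 + e - i) = n - (n div 2 + e - j)" by (metis cB)
    then show "i = j" using small[of i] small[of j] ij kl by auto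
  qed
  ultimately have "card ?S = k + l"
    using disj by (simp add: card_Un_disjoint card_image)
  then show ?thesis using ind by blast
qed

lemma exists_chain_independent:
  "\<exists>S. independent_set (middle_copy_graph P r n) S \<and> card S = sigma P r"
  using interval_family[of "sigma P r" 0 0] by simp

text \<open>
  Let the gap be \<open>Lp - 1\<close>. A pair of segments that leaves a gap, or none, without overlapping is
  disjoint with fewer than \<open>Lp\<close> elements outside, and an overlapping pair covers everything and
  overlaps in at most \<open>(k - 1) + (l - 1) - (Lp - 1) < Lm\<close> elements. The hypotheses exclude both from a
  common copy.
\<close>

lemma exists_two_chain_independent:
  assumes Lm: "\<And>\<iota> p q. strong_embedding P r n \<iota> \<Longrightarrow> incomparable P r p q \<Longrightarrow>
      \<iota> p \<union> \<iota> q = {1..n} \<Longrightarrow> Lm \<le> card (\<iota> p \<inter> \<iota> q)"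
    and Lp: "\<And>\<iota> p q. strong_embedding P r n \<iota> \<Longrightarrow> incomparable P r p q \<Longrightarrow>
      \<iota> p \<inter> \<iota> q = {} \<Longrightarrow> Lp \<le> n - card (\<iota> p \<union> \<iota> q)"
    and kl: "k \<le> sigma P r" "l \<le> sigma P r" "k + l \<le> Lm + Lp" and pos: "1 \<le> Lp"
    and le: "Lp \<le> lambda_plus P r + 1"
  shows "\<exists>S. independent_set (middle_copy_graph P r n) S \<and> card S = k + l"
proof (rule interval_family)
  let ?e = "Lp - 1"
  show "k \<le> sigma P r" "l \<le> sigma P r" "?e \<le> lambda_plus P r + 1" using kl le by auto
  fix i j assume ij: "i < k" "j < l"
  let ?A = "{1..n div 2 + i}" and ?B = "{n div 2 + ?e - j + 1..n}"
  have b: "j \<le> n div 2" "n div 2 + ?e \<le> n" "n div 2 + i < n" "n div 2 + ?e - j < n" "1 \<le> n div 2 + ?e - j"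
      "1 \<le> n div 2 + i"
    using ij kl large le by linarith+
  show "\<not> copy_adjacent P r n ?A ?B"
  proof
    assume adj: "copy_adjacent P r n ?A ?B"
    have "n \<in> ?B" "n \<notin> ?A" "1 \<in> ?A" "1 \<notin> ?B" using b by auto
    then have "\<not> ?A \<subseteq> ?B" "\<not> ?B \<subseteq> ?A" by blast+
    then obtain \<iota> p q where h: "strong_embedding P r n \<iota>" "incomparable P r p q" "\<iota> p = ?A" "\<iota> q = ?B"
      using incomparable_adjacentE[OF adj] by metis
    show False
    proof (cases "n div 2 + ?e - j \<le> n div 2 + i")
      case True
      then have "?A \<union> ?B = {1..n}" "?A \<inter> ?B = {n div 2 + ?e - j + 1..n div 2 + i}"
        using b by auto
      then show False using Lm[OF h(1,2)] h ij kl True b pos by simp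
    next
      case False
      then have "?A \<inter> ?B = {}" by auto
      then have "Lp \<le> n - card (?A \<union> ?B)" using Lp[OF h(1,2)] h(3,4) by simp
      also have "card (?A \<union> ?B) = (n div 2 + i) + (n - (n div 2 + ?e - j))"
        using \<open>?A \<inter> ?B = {}\<close> by (subst card_Un_disjoint) auto
      finally show False using b pos by linarith
    qed
  qed
qed

lemma independence_number_good:
  assumes "incomparable_good P r"
  shows "independence_number (middle_copy_graph P r n) = sigma P r"
  using exists_chain_independent card_independent_good assms by (metis independence_number_eqI)

lemma independence_number_bad:
  assumes "incomparable_upper_bad P r \<or> incomparable_lower_bad P r"
  shows "independence_number (middle_copy_graph P r n) = 2"
proof -
  have s: "sigma P r = 1" using sigma_eq_one not_chain not_antichain assms by blast
  have bad: "\<not> incomparable_good P r"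
    using assms unfolding incomparable_good_def incomparable_upper_bad_def
      incomparable_lower_bad_def strong_bad_def by blast
  have "\<exists>S. independent_set (middle_copy_graph P r n) S \<and> card S = 1 + 1"
  proof (rule exists_two_chain_independent[where Lm = 1 and Lp = 1])
    fix \<iota> p q assume h: "strong_embedding P r n \<iota>" "incomparable P r p q"
    have pq: "p \<in> P" "q \<in> P" using h(2) by (auto simp: incomparable_def)
    have sub: "\<iota> p \<subseteq> {1..n}" "\<iota> q \<subseteq> {1..n}" using h(1) pq unfolding strong_embedding_def by blast+
    have fin: "finite (\<iota> p)" "finite (\<iota> q)" using sub finite_subset by blast+
    show "1 \<le> card (\<iota> p \<inter> \<iota> q)" if "\<iota> p \<union> \<iota> q = {1..n}"
    proof -
      have "\<iota> p \<inter> \<iota> q \<noteq> {}" using exact_complements_not_embedded[OF bad h that] by blast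
      then show ?thesis using fin by (simp add: Suc_le_eq card_gt_0_iff)
    qed
    show "1 \<le> n - card (\<iota> p \<union> \<iota> q)" if "\<iota> p \<inter> \<iota> q = {}"
    proof -
      have "\<iota> p \<union> \<iota> q \<subset> {1..n}"
        using exact_complements_not_embedded[OF bad h _ that] sub by blast
      then have "card (\<iota> p \<union> \<iota> q) < card {1..n}" by (intro psubset_card_mono) auto
      then show ?thesis by simp
    qed
  qed (use s in auto)
  then show ?thesis
    using card_independent_le_two_sigma s
    by (metis independence_number_eqI mult.right_neutral one_add_one)
qed

lemma independence_number_mixed:
  assumes mixed: "incomparable_mixed_bad P r"
  shows "independence_number (middle_copy_graph P r n) =
    max (sigma P r) (min (lambda_minus P r + lambda_plus P r) (2 * sigma P r))"
proof -
  let ?t = "min (lambda_minus P r + lambda_plus P r) (2 * sigma P r)"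
  have bad: "\<not> incomparable_good P r" "\<not> incomparable_upper_bad P r" "\<not> incomparable_lower_bad P r"
    using mixed by (auto simp: incomparable_good_def incomparable_mixed_bad_def)
  obtain N \<iota> p q where h: "strong_embedding P r N \<iota>" "incomparable P r p q"
      "\<iota> p \<inter> \<iota> q = {}" "N - card (\<iota> p \<union> \<iota> q) = lambda_plus P r"
    using lambda_plus_attained[OF bad(3)] by blast
  have "\<iota> p \<union> \<iota> q \<subseteq> {1..N}"
    using h(1,2) unfolding strong_embedding_def incomparable_def by blast
  moreover have "\<iota> p \<union> \<iota> q \<noteq> {1..N}"
    using exact_complements_not_embedded[OF bad(1) h(1,2) _ h(3)] by blast
  ultimately have "card (\<iota> p \<union> \<iota> q) < card {1..N}" by (intro psubset_card_mono) auto
  then have pos: "1 \<le> lambda_plus P r" using h(4) by simp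
  \<comment> \<open>Splitting \<open>?t\<close> evenly keeps both chains within \<open>sigma P r\<close>.\<close>
  have half: "?t div 2 + (?t - ?t div 2) = ?t" by simp
  have "\<exists>S. independent_set (middle_copy_graph P r n) S \<and> card S = ?t div 2 + (?t - ?t div 2)"
    by (rule exists_two_chain_independent[OF lambda_minus_le lambda_plus_le _ _ _ pos]) auto
  then have "\<exists>S. independent_set (middle_copy_graph P r n) S \<and> card S = max (sigma P r) ?t"
    using exists_chain_independent unfolding half max_def by presburger
  then show ?thesis
    using card_independent_mixed[OF _ mixed] by (metis independence_number_eqI)
qed

end

text \<open>
  With \<open>t\<close> the cube root of \<open>n\<close>, the window \<open>n powr (2 / 3)\<close> is \<open>t\<^sup>2\<close> and both bounds follow from
  \<open>t \<ge> 16\<close> and \<open>t \<ge> C\<close>; note that \<open>16 ^ 3 = 4096\<close>.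
\<close>

lemma window_bounds:
  fixes C :: nat
  assumes "n \<ge> 4096 + C ^ 3"
  shows "real n powr (2 / 3) \<le> real n / 16" "real C \<le> real n powr (2 / 3)" "C \<le> n"
proof -
  define t where "t = real n powr (1 / 3)"
  have npos: "real n > 0" using assms by simp
  have t2: "real n powr (2 / 3) = t ^ 2" and t3: "real n = t ^ 3"
    using npos by (simp_all add: t_def powr_realpow[symmetric] powr_powr)
  have tpos: "t > 0" using npos by (simp add: t_def)
  have big: "real 4096 + real C ^ 3 \<le> t ^ 3"
    using assms t3 by (metis of_nat_add of_nat_le_iff of_nat_power)
  have t16: "t \<ge> 16"
  proof (rule ccontr)
    assume "\<not> ?thesis"
    then have "t ^ 3 < 16 ^ 3" using tpos by (intro power_strict_mono) auto
    moreover have "0 \<le> real C ^ 3" by simp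
    ultimately show False using big by simp
  qed
  have tC: "real C \<le> t"
  proof (rule ccontr)
    assume "\<not> ?thesis"
    then have "t ^ 3 < real C ^ 3" using tpos by (intro power_strict_mono) auto
    then show False using big by simp
  qed
  show "real n powr (2 / 3) \<le> real n / 16"
    unfolding t2 unfolding t3 using t16 tpos by (simp add: power2_eq_square power3_eq_cube)
  have "t * 1 \<le> t * t" using t16 by (intro mult_left_mono) auto
  then show "real C \<le> real n powr (2 / 3)"
    unfolding t2 using tC by (simp add: power2_eq_square)
  have "C \<le> C ^ 3" by (cases "C = 0") (simp_all add: self_le_power)
  then show "C \<le> n" using assms by simp
qed

section \<open>Crowns\<close>

text \<open>
  Minimal elements \<open>0, \<dots>, m - 1\<close> and maximal elements \<open>m, \<dots>, 2 m - 1\<close>, with \<open>i\<close> below \<open>m + j\<close> iff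
  \<open>i \<noteq> j\<close>: the standard example of a poset of dimension \<open>m\<close>.
\<close>

definition crown :: "nat \<Rightarrow> nat rel" where
  "crown m = {(x, x) | x. x < 2 * m} \<union> {(i, m + j) | i j. i < m \<and> j < m \<and> i \<noteq> j}"

lemma finite_poset_crown: "finite_poset {..<2 * m} (crown m)"
  unfolding finite_poset_def partial_order_on_def preorder_on_def
  by (auto simp: crown_def refl_on_def trans_def antisym_def)

text \<open>
  Consider \<open>p = i\<close> below \<open>q = m + j\<close>. For every other \<open>k\<close> the sets \<open>\<iota> k\<close> and \<open>\<iota> (m + k)\<close> must be
  separated by some \<open>w k \<in> \<iota> k - \<iota> (m + k)\<close>. This element lies in \<open>\<iota> q\<close>, as \<open>k\<close> is below \<open>q\<close>, and not
  in \<open>\<iota> p\<close>, as \<open>p\<close> is below \<open>m + k\<close>. The \<open>w k\<close> are distinct, since \<open>\<iota> k \<subseteq> \<iota> (m + l)\<close> for \<open>k \<noteq> l\<close>.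
\<close>

lemma sigma_crown_ge:
  assumes "\<not> is_antichain {..<2 * m} (crown m)"
  shows "m - 2 \<le> sigma {..<2 * m} (crown m)"
proof -
  interpret poset_carrier "{..<2 * m}" "crown m"
    by unfold_locales (rule finite_poset_crown)
  obtain N \<iota> p q where h: "strong_embedding {..<2 * m} (crown m) N \<iota>" "(p, q) \<in> crown m" "p \<noteq> q"
      "card (\<iota> q - \<iota> p) = sigma {..<2 * m} (crown m)"
    using sigma_attained[OF assms] by blast
  obtain i j where ij: "p = i" "q = m + j" "i < m" "j < m" "i \<noteq> j"
    using h(2,3) by (auto simp: crown_def)
  have le: "(x, y) \<in> crown m \<longleftrightarrow> \<iota> x \<subseteq> \<iota> y" if "x < 2 * m" "y < 2 * m" for x y
    using h(1) that by (auto simp: strong_embedding_def)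
  have below: "\<iota> k \<subseteq> \<iota> (m + l)" if "k < m" "l < m" "k \<noteq> l" for k l
    using le[of k "m + l"] that by (auto simp: crown_def)
  have "\<not> \<iota> k \<subseteq> \<iota> (m + k)" if "k < m" for k
    using le[of k "m + k"] that by (auto simp: crown_def)
  then have "\<exists>w. \<forall>k<m. w k \<in> \<iota> k \<and> w k \<notin> \<iota> (m + k)"
    by (intro choice_iff'[THEN iffD1]) blast
  then obtain w where w: "\<And>k. k < m \<Longrightarrow> w k \<in> \<iota> k \<and> w k \<notin> \<iota> (m + k)" by blast
  have "inj_on w ({..<m} - {i, j})"
  proof (rule inj_onI, rule ccontr)
    fix k l assume kl: "k \<in> {..<m} - {i, j}" "l \<in> {..<m} - {i, j}" "w k = w l" "k \<noteq> l"
    then have "w k \<in> \<iota> (m + l)" using below[of k l] w[of k] by auto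
    then show False using kl w[of l] by auto
  qed
  then have "card ({..<m} - {i, j}) = card (w ` ({..<m} - {i, j}))" by (simp add: card_image)
  also have "\<dots> \<le> card (\<iota> q - \<iota> p)"
  proof (rule card_mono)
    have "q \<in> {..<2 * m}" using ij by simp
    then have "\<iota> q \<subseteq> {1..N}" using h(1) unfolding strong_embedding_def by blast
    then show "finite (\<iota> q - \<iota> p)" using finite_subset by blast
    show "w ` ({..<m} - {i, j}) \<subseteq> \<iota> q - \<iota> p"
      using w below ij by fastforce
  qed
  finally show ?thesis using h(4) ij by (simp add: card_Diff_subset)
qed

text \<open>
  In a crown the pair \<open>0\<close>, \<open>m\<close> is incomparable and good: it has no common upper bound, because \<open>m\<close> is
  maximal, and no common lower bound, because \<open>0\<close> is minimal.
\<close>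

lemma exists_good_poset_large_sigma:
  "\<exists>(Q :: nat set) s. finite_poset Q s \<and> \<not> total_on Q s \<and> \<not> is_antichain Q s \<and>
        incomparable_good Q s \<and> sigma Q s \<ge> M"
proof -
  let ?m = "M + 2"
  let ?Q = "{..<2 * ?m}"
  have inc: "incomparable ?Q (crown ?m) 0 ?m" by (auto simp: incomparable_def crown_def)
  then have nt: "\<not> total_on ?Q (crown ?m)" by (auto simp: incomparable_def total_on_def)
  have "(0, ?m + 1) \<in> crown ?m" by (auto simp: crown_def)
  then have na: "\<not> is_antichain ?Q (crown ?m)" unfolding is_antichain_def by fastforce
  have "aboveS (crown ?m) ?m = {}" "underS (crown ?m) 0 = {}"
    by (auto simp: aboveS_def underS_def crown_def)
  then have "\<not> strong_bad ?Q (crown ?m) 0 ?m"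
    by (simp add: strong_bad_def strong_upper_bad_def strong_lower_bad_def)
  then have "incomparable_good ?Q (crown ?m)" using inc by (auto simp: incomparable_good_def)
  then show ?thesis
    using finite_poset_crown[of ?m] nt na sigma_crown_ge[OF na] by fastforce
qed

theorem theorem1p7:
  shows "(\<forall>(P :: 'a set) r. finite_poset P r \<and> \<not> total_on P r \<and> \<not> is_antichain P r \<longrightarrow>
      (\<exists>n0. \<forall>n\<ge>n0.
        (\<forall>S. independent_set (middle_copy_graph P r n) S \<longrightarrow>
           chain_subset S \<or> (\<exists>C D. chain_subset C \<and> chain_subset D \<and> S = C \<union> D)) \<and>
        (incomparable_good P r \<longrightarrow>
           independence_number (middle_copy_graph P r n) = sigma P r) \<and>
        (incomparable_upper_bad P r \<or> incomparable_lower_bad P r \<longrightarrow>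
           independence_number (middle_copy_graph P r n) = 2) \<and>
        (incomparable_mixed_bad P r \<longrightarrow>
           independence_number (middle_copy_graph P r n) =
             max (sigma P r) (min (lambda_minus P r + lambda_plus P r) (2 * sigma P r))))) \<and>
    (\<forall>M. \<exists>(Q :: nat set) s. finite_poset Q s \<and> \<not> total_on Q s \<and> \<not> is_antichain Q s \<and>
        incomparable_good Q s \<and> sigma Q s \<ge> M)"
proof (intro conjI allI impI)
  fix P :: "'a set" and r
  assume a: "finite_poset P r \<and> \<not> total_on P r \<and> \<not> is_antichain P r"
  define C where "C = 48 * (2 ^ card P + sigma P r + lambda_plus P r + 1)"
  show "\<exists>n0. \<forall>n\<ge>n0.
        (\<forall>S. independent_set (middle_copy_graph P r n) S \<longrightarrow>
           chain_subset S \<or> (\<exists>C D. chain_subset C \<and> chain_subset D \<and> S = C \<union> D)) \<and>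
        (incomparable_good P r \<longrightarrow>
           independence_number (middle_copy_graph P r n) = sigma P r) \<and>
        (incomparable_upper_bad P r \<or> incomparable_lower_bad P r \<longrightarrow>
           independence_number (middle_copy_graph P r n) = 2) \<and>
        (incomparable_mixed_bad P r \<longrightarrow>
           independence_number (middle_copy_graph P r n) =
             max (sigma P r) (min (lambda_minus P r + lambda_plus P r) (2 * sigma P r)))"
  proof (rule exI[of _ "4096 + C ^ 3"], intro allI impI)
    fix n assume n: "n \<ge> 4096 + C ^ 3"
    have "sigma P r + lambda_plus P r + 2 \<le> C" by (simp add: C_def)
    then have "real (sigma P r + lambda_plus P r + 2) \<le> real C" by (simp only: of_nat_le_iff)
    then have window: "real (sigma P r + lambda_plus P r + 2) \<le> real n powr (2 / 3)"
      using window_bounds(2)[OF n] by linarith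
    interpret large_ground P r n
      using a window window_bounds(1,3)[OF n] unfolding C_def by unfold_locales blast+
    show "(\<forall>S. independent_set (middle_copy_graph P r n) S \<longrightarrow>
           chain_subset S \<or> (\<exists>C D. chain_subset C \<and> chain_subset D \<and> S = C \<union> D)) \<and>
        (incomparable_good P r \<longrightarrow>
           independence_number (middle_copy_graph P r n) = sigma P r) \<and>
        (incomparable_upper_bad P r \<or> incomparable_lower_bad P r \<longrightarrow>
           independence_number (middle_copy_graph P r n) = 2) \<and>
        (incomparable_mixed_bad P r \<longrightarrow>
           independence_number (middle_copy_graph P r n) =
             max (sigma P r) (min (lambda_minus P r + lambda_plus P r) (2 * sigma P r)))"
      using independence_number_good independence_number_bad independence_number_mixed
        independent_structure by metis
  qed
next
  fix M
  show "\<exists>(Q :: nat set) s. finite_poset Q s \<and> \<not> total_on Q s \<and> \<not> is_antichain Q s \<and>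
        incomparable_good Q s \<and> sigma Q s \<ge> M"
    by (rule exists_good_poset_large_sigma)
qed

end
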